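(* Let $a>0$ and $p\in\mathbb{R}$ be constants, let $\Pi=(0,1)\times(0,\infty)$, and let $c:\overline{\Pi}\to\mathbb{R}$ be a twice continuously differentiable function such that $c$ and its first and second order partial derivatives are bounded on $\overline{\Pi}$. Consider the initial-boundary value problem $$w_{tt}-a^2w_{xx}+c(x,t)w=0,\quad (x,t)\in\Pi,$$ $$w(0,t)=p\,(w_t+aw_x)(0,t),\qquad (w_t+aw_x)(1,t)=0,\quad t\in(0,\infty),$$ $$w(x,0)=w_0(x),\qquad w_t(x,0)=w_1(x),\quad x\in[0,1].$$ This problem is smoothing from $L^2(0,1)$ to $C^2([0,1])$ with $T=6/a$; that is, for all $w_0\in H^1(0,1)$ and $w_1\in L^2(0,1)$ the $L^2$-generalized solution $w$ satisfies $w(\cdot,t)\in C^2([0,1])$ for every $t\ge T=6/a$. Moreover, there are constants $M_1$ and $\omega$, not depending on $t$, $w_0$, $w_1$, such that for all $w_0\in H^1(0,1)$, $w_1\in L^2(0,1)$ and all integers $\alpha,\beta\ge0$ with $\alpha+\beta\le2$, the $L^2$-generalized solution $w$ satisfies $$\|\partial_x^{\alpha}\partial_t^{\beta}w(\cdot,t)\|_{C([0,1])}\le M_1e^{\omega t}\max\left(\|w_0\|_{H^1(0,1)},\|w_1\|_{L^2(0,1)}\right)\quad\text{for all } t\ge T=6/a$$ (the existence of these derivatives being part of the assertion).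
   Context: $H^1(0,1)$ is the space of functions $u\in L^2(0,1)$ with weak derivative $u'\in L^2(0,1)$. Definition of the $L^2$-generalized solution. With $u=\partial_t w+a\,\partial_x w$, the wave problem is rewritten as the first order problem $$\partial_t w+a\,\partial_x w-u=0,\qquad \partial_t u-a\,\partial_x u+c(x,t)w=0,\qquad (x,t)\in\Pi,$$ $$w(0,t)=p\,u(0,t),\qquad u(1,t)=0,\qquad t>0,$$ $$w(x,0)=\varphi_1(x),\qquad u(x,0)=\varphi_2(x),\qquad x\in[0,1],$$ where $\varphi_1=w_0$ and $\varphi_2=w_1+a\,\partial_x w_0$ (both in $L^2(0,1)$). For initial data $\varphi_1,\varphi_2$ that are $C^\infty$ with compact support in $(0,1)$, this first order problem has a unique classical ($C^2$) solution. For general $w_0\in H^1(0,1)$, $w_1\in L^2(0,1)$, choose sequences $\varphi_1^l,\varphi_2^l\in C_0^\infty(0,1)$ with $\varphi_i^l\to\varphi_i$ in $L^2(0,1)$, $i=1,2$, and let $(w^l,u^l)$ be the classical solution of the first order problem with initial data $(\varphi_1^l,\varphi_2^l)$. There exist unique functions $w,u\in C([0,\infty),L^2(0,1))$ such that $\|w(\cdot,\theta)-w^l(\cdot,\theta)\|_{L^2(0,1)}\to0$ and $\|u(\cdot,\theta)-u^l(\cdot,\theta)\|_{L^2(0,1)}\to0$ as $l\to\infty$, uniformly in $\theta\in[0,t]$, for every $t>0$ (existence and uniqueness are known). The function $w$ is called the $L^2$-generalized solution of the wave problem. The wave problem is called smoothing from $L^2(0,1)$ to $C^2([0,1])$ if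 there is $T>0$ such that for all $w_0\in H^1(0,1)$ and $w_1\in L^2(0,1)$ the $L^2$-generalized solution $w(\cdot,t)$ belongs to $C^2([0,1])$ whenever $t\ge T$. As usual, elements of $L^2(0,1)$ are identified with their continuous representatives when these exist. *)

theory Defs
  imports "HOL-Analysis.Analysis"
begin

section \<open>Function spaces on the unit interval\<close>

text \<open>
  Elements of L2(0,1) are represented by functions on the reals whose values outside the open unit
  interval are irrelevant; equality in L2(0,1) is equality almost everywhere on the interval.
\<close>

abbreviation unit_lebesgue :: "real measure" where
  "unit_lebesgue \<equiv> lebesgue_on {0<..<1}"

definition L2 :: "(real \<Rightarrow> real) set" where
  "L2 = {f \<in> borel_measurable unit_lebesgue. integrable unit_lebesgue (\<lambda>x. (f x)\<^sup>2)}"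

definition L2_norm :: "(real \<Rightarrow> real) \<Rightarrow> real" where
  "L2_norm f = sqrt (LINT x|unit_lebesgue. (f x)\<^sup>2)"

text \<open>Smooth functions with compact support in the open unit interval, extended by zero.\<close>

definition test_functions :: "(real \<Rightarrow> real) set" where
  "test_functions = {\<phi>. (\<forall>n x. (deriv ^^ n) \<phi> field_differentiable at x) \<and>
     (\<exists>K. compact K \<and> K \<subseteq> {0<..<1} \<and> (\<forall>x. x \<notin> K \<longrightarrow> \<phi> x = 0))}"

definition has_weak_deriv :: "(real \<Rightarrow> real) \<Rightarrow> (real \<Rightarrow> real) \<Rightarrow> bool" where
  "has_weak_deriv f g \<longleftrightarrow> (\<forall>\<phi>\<in>test_functions.
     (LINT x|unit_lebesgue. f x * deriv \<phi> x) = - (LINT x|unit_lebesgue. g x * \<phi> x))"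

definition H1 :: "(real \<Rightarrow> real) set" where
  "H1 = {f \<in> L2. \<exists>g\<in>L2. has_weak_deriv f g}"

text \<open>
  A weak derivative is determined only up to null sets; the choice made here affects nothing that
  is defined below through \<open>L2_norm\<close>.
\<close>

definition weak_deriv :: "(real \<Rightarrow> real) \<Rightarrow> real \<Rightarrow> real" where
  "weak_deriv f = (SOME g. g \<in> L2 \<and> has_weak_deriv f g)"

definition H1_norm :: "(real \<Rightarrow> real) \<Rightarrow> real" where
  "H1_norm f = sqrt ((L2_norm f)\<^sup>2 + (L2_norm (weak_deriv f))\<^sup>2)"

definition C_norm :: "(real \<Rightarrow> real) \<Rightarrow> real" where
  "C_norm f = (SUP x\<in>{0..1}. \<bar>f x\<bar>)"

definition C2_unit_interval :: "(real \<Rightarrow> real) set" where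
  "C2_unit_interval = {f. \<exists>f' f''.
     (\<forall>x\<in>{0..1}. (f has_real_derivative f' x) (at x within {0..1}) \<and>
                 (f' has_real_derivative f'' x) (at x within {0..1})) \<and>
     continuous_on {0..1} f''}"

definition continuous_into_L2 :: "(real \<Rightarrow> real \<Rightarrow> real) \<Rightarrow> bool" where
  "continuous_into_L2 w \<longleftrightarrow>
     (\<forall>t\<ge>0. (\<lambda>x. w x t) \<in> L2) \<and>
     (\<forall>s\<ge>0. ((\<lambda>t. L2_norm (\<lambda>x. w x t - w x s)) \<longlongrightarrow> 0) (at s within {0..}))"

section \<open>Partial derivatives up to order two on strips\<close>

text \<open>
  Functions on the closed strip \<open>{0..1} \<times> {T..}\<close> are curried, with the space variable first.
  \<open>iterated_partials T v D\<close> says that for \<open>\<alpha> + \<beta> \<le> 2\<close> the function \<open>D \<alpha> \<beta>\<close> is the iterated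
  derivative of \<open>v\<close> obtained by differentiating \<open>\<beta>\<close> times in time and then \<open>\<alpha>\<close> times in space;
  on the boundary of the strip the derivatives are one-sided.
\<close>

definition iterated_partials ::
  "real \<Rightarrow> (real \<Rightarrow> real \<Rightarrow> real) \<Rightarrow> (nat \<Rightarrow> nat \<Rightarrow> real \<Rightarrow> real \<Rightarrow> real) \<Rightarrow> bool" where
  "iterated_partials T v D \<longleftrightarrow> (\<forall>x\<in>{0..1}. \<forall>t\<in>{T..}.
     D 0 0 x t = v x t \<and>
     (\<forall>\<beta><2. ((\<lambda>s. D 0 \<beta> x s) has_real_derivative D 0 (Suc \<beta>) x t) (at t within {T..})) \<and>
     (\<forall>\<alpha> \<beta>. \<alpha> + \<beta> < 2 \<longrightarrow>
        ((\<lambda>y. D \<alpha> \<beta> y t) has_real_derivative D (Suc \<alpha>) \<beta> x t) (at x within {0..1})))"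

text \<open>
  Twice continuous differentiability on the closed strip. The middle conjunct supplies the
  mixed derivative in the other order.
\<close>

definition C2_partials ::
  "(real \<Rightarrow> real \<Rightarrow> real) \<Rightarrow> (nat \<Rightarrow> nat \<Rightarrow> real \<Rightarrow> real \<Rightarrow> real) \<Rightarrow> bool" where
  "C2_partials v D \<longleftrightarrow>
     iterated_partials 0 v D \<and>
     (\<forall>x\<in>{0..1}. \<forall>t\<in>{0..}.
        ((\<lambda>s. D 1 0 x s) has_real_derivative D 1 1 x t) (at t within {0..})) \<and>
     (\<forall>\<alpha> \<beta>. \<alpha> + \<beta> \<le> 2 \<longrightarrow> continuous_on ({0..1} \<times> {0..}) (\<lambda>(x, t). D \<alpha> \<beta> x t))"

definition C2_strip :: "(real \<Rightarrow> real \<Rightarrow> real) set" where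
  "C2_strip = {v. \<exists>D. C2_partials v D}"

definition bounded_C2_strip :: "(real \<Rightarrow> real \<Rightarrow> real) set" where
  "bounded_C2_strip = {v. \<exists>D. C2_partials v D \<and>
     (\<forall>\<alpha> \<beta>. \<alpha> + \<beta> \<le> 2 \<longrightarrow> bounded ((\<lambda>(x, t). D \<alpha> \<beta> x t) ` ({0..1} \<times> {0..})))}"

section \<open>The initial-boundary value problem\<close>

definition classical_solution ::
  "real \<Rightarrow> real \<Rightarrow> (real \<Rightarrow> real \<Rightarrow> real) \<Rightarrow> (real \<Rightarrow> real) \<Rightarrow> (real \<Rightarrow> real) \<Rightarrow>
   (real \<Rightarrow> real \<Rightarrow> real) \<Rightarrow> (real \<Rightarrow> real \<Rightarrow> real) \<Rightarrow> bool" where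
  "classical_solution a p c \<phi>1 \<phi>2 w u \<longleftrightarrow>
     w \<in> C2_strip \<and> u \<in> C2_strip \<and>
     (\<forall>x\<in>{0<..<1}. \<forall>t>0.
        deriv (\<lambda>s. w x s) t + a * deriv (\<lambda>y. w y t) x - u x t = 0 \<and>
        deriv (\<lambda>s. u x s) t - a * deriv (\<lambda>y. u y t) x + c x t * w x t = 0) \<and>
     (\<forall>t>0. w 0 t = p * u 0 t \<and> u 1 t = 0) \<and>
     (\<forall>x\<in>{0..1}. w x 0 = \<phi>1 x \<and> u x 0 = \<phi>2 x)"

definition L2_generalized_solution ::
  "real \<Rightarrow> real \<Rightarrow> (real \<Rightarrow> real \<Rightarrow> real) \<Rightarrow> (real \<Rightarrow> real) \<Rightarrow> (real \<Rightarrow> real) \<Rightarrow>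
   (real \<Rightarrow> real \<Rightarrow> real) \<Rightarrow> bool" where
  "L2_generalized_solution a p c w0 w1 w \<longleftrightarrow>
     (\<exists>u \<phi>1 \<phi>2 W U.
        continuous_into_L2 w \<and> continuous_into_L2 u \<and>
        (\<forall>l::nat. \<phi>1 l \<in> test_functions \<and> \<phi>2 l \<in> test_functions) \<and>
        (\<lambda>l. L2_norm (\<lambda>x. \<phi>1 l x - w0 x)) \<longlonglongrightarrow> 0 \<and>
        (\<lambda>l. L2_norm (\<lambda>x. \<phi>2 l x - (w1 x + a * weak_deriv w0 x))) \<longlonglongrightarrow> 0 \<and>
        (\<forall>l. classical_solution a p c (\<phi>1 l) (\<phi>2 l) (W l) (U l)) \<and>
        (\<forall>t>0. uniform_limit {0..t} (\<lambda>l \<theta>. L2_norm (\<lambda>x. w x \<theta> - W l x \<theta>)) (\<lambda>\<theta>. 0) sequentially \<and>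
               uniform_limit {0..t} (\<lambda>l \<theta>. L2_norm (\<lambda>x. u x \<theta> - U l x \<theta>)) (\<lambda>\<theta>. 0) sequentially))"

text \<open>Smoothing from L2(0,1) to C2([0,1]), with the time from which it holds made explicit.\<close>

definition smoothing_L2_C2_from ::
  "real \<Rightarrow> real \<Rightarrow> (real \<Rightarrow> real \<Rightarrow> real) \<Rightarrow> real \<Rightarrow> bool" where
  "smoothing_L2_C2_from a p c T \<longleftrightarrow> T > 0 \<and>
     (\<forall>w0\<in>H1. \<forall>w1\<in>L2. \<forall>w. L2_generalized_solution a p c w0 w1 w \<longrightarrow>
        (\<forall>t\<ge>T. \<exists>g\<in>C2_unit_interval. AE x in unit_lebesgue. w x t = g x))"

end

theory Submission
  imports Defs
begin

text \<open>
  With \<open>u = w\<^sub>t + a w\<^sub>x\<close> the equation is a pair of transport equations: \<open>w\<close> is carried to the right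
  with source \<open>u\<close>, and \<open>u\<close> is carried to the left with source \<open>- c w\<close>. Every leftward characteristic
  that is followed back in time for at least \<open>1 / a\<close> starts on \<open>x = 1\<close>, where \<open>u = 0\<close>, and every
  rightward one starts on \<open>x = 0\<close>, where \<open>w = p u\<close>. After two crossings of the interval
  the initial data are therefore visible only through integrals of the solution, and this is where
  the smoothing comes from. The coupling allows one to integrate by parts along characteristics, so
  that each further round trip, of duration \<open>2 / a\<close>, gains one derivative.

  Quantitatively, for a classical solution whose data have size \<open>N\<close> in L2, each of the following is at
  most a constant multiple of \<open>N exp (\<omega> t)\<close>:
  \<open>u\<close> for \<open>t \<ge> 1 / a\<close>, \<open>w\<close> for \<open>t \<ge> 2 / a\<close>, \<open>u\<^sub>t\<close> for \<open>t \<ge> 3 / a\<close>, \<open>w\<^sub>t\<close> for \<open>t \<ge> 4 / a\<close>, \<open>u\<^sub>t\<^sub>t\<close> for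
  \<open>t \<ge> 5 / a\<close> and \<open>w\<^sub>t\<^sub>t\<close> for \<open>t \<ge> 6 / a\<close>; the equations then give the remaining derivatives of \<open>w\<close> up
  to order two. The first bound (\<open>u_sup_bound\<close>) is the only one that uses L2 information. It rests on
  an energy whose flux through the left end and through a leftward characteristic has a sign
  (\<open>localized_energy_derivative\<close>), so that the energy controls \<open>w\<close> in L2 along the characteristic on
  which \<open>u\<close> is an integral of \<open>w\<close>. All later bounds (\<open>derivative_bounds\<close>) are sup bounds along
  characteristics. Only \<open>u\<^sub>t\<close> is delicate, because its source \<open>- (c w)\<^sub>t\<close> contains \<open>w\<^sub>t\<close>, which is not
  yet under control. The combination \<open>q = u\<^sub>t + c w / 2\<close> satisfies
    \<open>q\<^sub>t - a q\<^sub>x = - ((c\<^sub>t + a c\<^sub>x) w + c u) / 2\<close>,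
  whose right-hand side contains no derivatives of \<open>w\<close> and \<open>u\<close>: on leftward characteristics \<open>w\<^sub>t\<close> is,
  up to the known \<open>u / 2\<close>, a multiple of the derivative of \<open>w\<close> along the characteristic.

  Differences of classical solutions are again classical solutions, so the bounds make all derivatives
  up to order two of an approximating sequence converge, locally uniformly for \<open>t \<ge> 6 / a\<close>; the
  limits are the derivatives of the generalized solution and inherit the bounds
  (\<open>generalized_solution_regularity\<close>).
\<close>

section \<open>Differentiable functions on the strip\<close>

text \<open>
  Derivatives are one-sided on the boundary of the strip, and they are carried along as explicit
  functions: second derivatives enter below as the first derivatives of such a function.
\<close>

definition C1_strip ::
  "(real \<Rightarrow> real \<Rightarrow> real) \<Rightarrow> (real \<Rightarrow> real \<Rightarrow> real) \<Rightarrow> (real \<Rightarrow> real \<Rightarrow> real) \<Rightarrow> bool" where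
  "C1_strip f fx ft \<longleftrightarrow>
     (\<forall>x\<in>{0..1}. \<forall>t\<ge>0. ((\<lambda>y. f y t) has_real_derivative fx x t) (at x within {0..1}) \<and>
        ((\<lambda>s. f x s) has_real_derivative ft x t) (at t within {0..})) \<and>
     continuous_on ({0..1} \<times> {0..}) (\<lambda>(x, t). f x t) \<and>
     continuous_on ({0..1} \<times> {0..}) (\<lambda>(x, t). fx x t) \<and>
     continuous_on ({0..1} \<times> {0..}) (\<lambda>(x, t). ft x t)"

lemma C1_stripD:
  assumes "C1_strip f fx ft"
  shows "\<lbrakk>0 \<le> x; x \<le> 1; 0 \<le> t\<rbrakk> \<Longrightarrow> ((\<lambda>y. f y t) has_real_derivative fx x t) (at x within {0..1})"
    and "\<lbrakk>0 \<le> x; x \<le> 1; 0 \<le> t\<rbrakk> \<Longrightarrow> ((\<lambda>s. f x s) has_real_derivative ft x t) (at t within {0..})"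
    and "continuous_on ({0..1} \<times> {0..}) (\<lambda>(x, t). f x t)"
    and "continuous_on ({0..1} \<times> {0..}) (\<lambda>(x, t). fx x t)"
    and "continuous_on ({0..1} \<times> {0..}) (\<lambda>(x, t). ft x t)"
  using assms by (auto simp: C1_strip_def)

lemma continuous_on_strip_compose:
  fixes f :: "real \<Rightarrow> real \<Rightarrow> real"
  assumes "continuous_on ({0..1} \<times> {0..}) (\<lambda>(x, t). f x t)" "continuous_on S g" "continuous_on S h"
    and "\<And>z. z \<in> S \<Longrightarrow> g z \<in> {0..1}" "\<And>z. z \<in> S \<Longrightarrow> h z \<ge> 0"
  shows "continuous_on S (\<lambda>z. f (g z) (h z))"
proof -
  have "continuous_on S (\<lambda>z. (g z, h z))"
    using assms(2,3) by (intro continuous_intros)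
  moreover have "(\<lambda>z. (g z, h z)) ` S \<subseteq> {0..1} \<times> {0..}"
    using assms(4,5) by fastforce
  ultimately show ?thesis
    using continuous_on_compose2[OF assms(1), of S "\<lambda>z. (g z, h z)"] by simp
qed

lemma C1_strip_cmult:
  assumes "C1_strip f fx ft"
  shows "C1_strip (\<lambda>x t. k * f x t) (\<lambda>x t. k * fx x t) (\<lambda>x t. k * ft x t)"
  using assms unfolding C1_strip_def split_beta
  by (auto intro!: derivative_eq_intros continuous_intros)

lemma C1_strip_add:
  assumes "C1_strip f fx ft" "C1_strip g gx gt"
  shows "C1_strip (\<lambda>x t. f x t + g x t) (\<lambda>x t. fx x t + gx x t) (\<lambda>x t. ft x t + gt x t)"
  using assms unfolding C1_strip_def split_beta
  by (auto intro!: derivative_eq_intros continuous_intros)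

lemma C1_strip_diff:
  assumes "C1_strip f fx ft" "C1_strip g gx gt"
  shows "C1_strip (\<lambda>x t. f x t - g x t) (\<lambda>x t. fx x t - gx x t) (\<lambda>x t. ft x t - gt x t)"
  using assms unfolding C1_strip_def split_beta
  by (auto intro!: derivative_eq_intros continuous_intros)

lemma C1_strip_mult:
  assumes "C1_strip f fx ft" "C1_strip g gx gt"
  shows "C1_strip (\<lambda>x t. f x t * g x t) (\<lambda>x t. fx x t * g x t + f x t * gx x t)
    (\<lambda>x t. ft x t * g x t + f x t * gt x t)"
  using assms unfolding C1_strip_def split_beta
  by (auto intro!: derivative_eq_intros continuous_intros simp: algebra_simps)

lemma C1_strip_shift:
  assumes "C1_strip f fx ft" "\<delta> \<ge> 0"
  shows "C1_strip (\<lambda>x t. f x (t + \<delta>)) (\<lambda>x t. fx x (t + \<delta>)) (\<lambda>x t. ft x (t + \<delta>))"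
proof -
  have c: "continuous_on ({0..1} \<times> {0..}) (\<lambda>(x, t). g x (t + \<delta>))"
    if "continuous_on ({0..1} \<times> {0..}) (\<lambda>(x, t). g x t)" for g :: "real \<Rightarrow> real \<Rightarrow> real"
    unfolding split_beta using assms(2)
    by (intro continuous_on_strip_compose[OF that] continuous_intros) auto
  have "((\<lambda>s. f x (s + \<delta>)) has_real_derivative ft x (t + \<delta>)) (at t within {0..})"
    if "x \<in> {0..1}" "t \<ge> 0" for x t
  proof -
    have "((\<lambda>s. f x s) has_real_derivative ft x (t + \<delta>)) (at (t + \<delta>) within {0..})"
      using assms that by (auto simp: C1_strip_def)
    then have "((\<lambda>s. f x s) has_real_derivative ft x (t + \<delta>)) (at (t + \<delta>) within (\<lambda>s. s + \<delta>) ` {0..})"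
      by (rule DERIV_subset) (use assms in auto)
    moreover have "((\<lambda>s. s + \<delta>) has_real_derivative 1) (at t within {0..})"
      by (auto intro!: derivative_eq_intros)
    ultimately show ?thesis
      using DERIV_image_chain[of "\<lambda>s. f x s" _ "\<lambda>s. s + \<delta>" t "{0..}" 1] by (simp add: o_def)
  qed
  then show ?thesis using assms c by (auto simp: C1_strip_def)
qed

lemma C1_strip_has_derivative:
  assumes "C1_strip f fx ft" "0 \<le> x" "x \<le> 1" "0 \<le> t"
  shows "((\<lambda>(x, t). f x t) has_derivative (\<lambda>(h, k). h * fx x t + k * ft x t))
    (at (x, t) within {0..1} \<times> {0..})"
proof -
  have 1: "((\<lambda>y. f y t) has_derivative (\<lambda>h. h * fx x t)) (at x within {0..1})"
    using C1_stripD(1)[OF assms] by (simp add: has_field_derivative_def mult.commute[of "fx x t"] mult_commute_abs)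
  have 2: "((\<lambda>s. f y s) has_derivative blinfun_apply (blinfun_mult_left (ft y s))) (at s within {0..})"
    if "y \<in> {0..1}" "s \<in> {0..}" for y s
    using C1_stripD(2)[OF assms(1), of y s] that
    by (simp add: has_field_derivative_def mult_commute_abs)
  have "continuous_on ({0..1} \<times> {0..}) (\<lambda>z. blinfun_mult_left (case z of (x, t) \<Rightarrow> ft x t))"
    by (rule bounded_linear.continuous_on[OF bounded_linear_blinfun_mult_left C1_stripD(5)[OF assms(1)]])
  then have "continuous (at (x, t) within {0..1} \<times> {0..}) (\<lambda>(x, t). blinfun_mult_left (ft x t))"
    using assms unfolding continuous_on_eq_continuous_within split_beta by auto
  from has_derivative_partialsI[OF 1 2 this] assms show ?thesis
    by (simp add: split_beta)
qed

text \<open>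
  The chain rule along a curve that may run into the boundary of the strip; total
  differentiability within the closed strip is what makes it hold there as well.
\<close>

lemma C1_strip_along_curve:
  assumes f: "C1_strip f fx ft" and l: "(l has_real_derivative l') (at s within S)"
    and S: "\<And>r. r \<in> S \<Longrightarrow> l r \<in> {0..1} \<and> 0 \<le> r" and s: "s \<in> S"
  shows "((\<lambda>r. f (l r) r) has_real_derivative l' * fx (l s) s + ft (l s) s) (at s within S)"
proof -
  have "((\<lambda>r. (l r, r)) has_derivative (\<lambda>h. (h * l', h))) (at s within S)"
    using l by (auto simp: has_field_derivative_def mult.commute intro!: derivative_eq_intros)
  moreover have "((\<lambda>(x, t). f x t) has_derivative (\<lambda>(h, k). h * fx (l s) s + k * ft (l s) s))
      (at (l s, s) within (\<lambda>r. (l r, r)) ` S)"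
    by (rule has_derivative_subset[OF C1_strip_has_derivative[OF f]]) (use S s in force)+
  ultimately have "((\<lambda>r. case (l r, r) of (x, t) \<Rightarrow> f x t) has_derivative
      (\<lambda>k. case (k * l', k) of (h, k) \<Rightarrow> h * fx (l s) s + k * ft (l s) s)) (at s within S)"
    by (rule has_derivative_in_compose)
  then have "((\<lambda>r. f (l r) r) has_derivative (\<lambda>k. k * (l' * fx (l s) s + ft (l s) s))) (at s within S)"
    by (simp add: algebra_simps)
  then show ?thesis
    by (simp add: has_field_derivative_def mult_commute_abs)
qed

lemma nonincreasing_of_deriv_nonpos:
  fixes f :: "real \<Rightarrow> real"
  assumes "\<alpha> \<le> \<beta>"
    and f: "\<And>s. s \<in> {\<alpha>..\<beta>} \<Longrightarrow> (f has_real_derivative f' s) (at s within {\<alpha>..\<beta>})"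
    and "\<And>s. s \<in> {\<alpha>..\<beta>} \<Longrightarrow> f' s \<le> 0"
  shows "f \<beta> \<le> f \<alpha>"
proof (rule DERIV_nonpos_imp_decreasing_open[OF \<open>\<alpha> \<le> \<beta>\<close>])
  fix s assume "\<alpha> < s" "s < \<beta>"
  then show "\<exists>y. DERIV f s :> y \<and> y \<le> 0"
    using f[of s] assms(3)[of s] at_within_Icc_at[of \<alpha> s \<beta>] by auto
next
  show "continuous_on {\<alpha>..\<beta>} f"
    using f by (meson DERIV_continuous continuous_on_eq_continuous_within)
qed

section \<open>Energy on domains with a moving endpoint\<close>

lemma C1_strip_dilate:
  assumes f: "C1_strip f fx ft" and k: "k \<in> {0..1}" and z: "z \<in> {0..1}" and s: "s \<ge> 0"
  shows "((\<lambda>z. f (k * z) s) has_real_derivative k * fx (k * z) s) (at z within {0..1})"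
proof -
  have kz: "0 \<le> k * y \<and> k * y \<le> 1" if "y \<in> {0..1}" for y
    using k that by (auto intro: mult_le_one)
  have "((\<lambda>y. f y s) has_real_derivative fx (k * z) s) (at (k * z) within {0..1})"
    using C1_stripD(1)[OF f] kz z s by auto
  then have "((\<lambda>y. f y s) has_real_derivative fx (k * z) s) (at (k * z) within (\<lambda>y. k * y) ` {0..1})"
    by (rule DERIV_subset) (use kz in auto)
  moreover have "((\<lambda>y. k * y) has_real_derivative k) (at z within {0..1})"
    by (auto intro!: derivative_eq_intros)
  ultimately have "((\<lambda>y. f y s) \<circ> (\<lambda>y. k * y) has_real_derivative fx (k * z) s * k) (at z within {0..1})"
    by (rule DERIV_image_chain)
  then show ?thesis
    by (simp add: o_def mult.commute[of "fx (k * z) s"])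
qed

text \<open>
  The moving interval from \<open>0\<close> to \<open>l s\<close> is mapped to the unit interval by \<open>y = l s * z\<close>, so that the
  integral of the density \<open>e\<close> depends on \<open>s\<close> through its integrand only. The flux \<open>f\<close> contributes
  its values at the two end points, and \<open>m * e\<close> is the density swept out by the endpoint, which moves to the left with speed \<open>m\<close>.
\<close>

lemma moving_domain_balance:
  assumes e: "C1_strip e ex et" and f: "C1_strip f fx ft"
    and l_def: "l = (\<lambda>s. b - m * s)"
    and S: "\<And>s. s \<in> {\<alpha>..\<beta>} \<Longrightarrow> l s \<in> {0..1} \<and> 0 \<le> s" and s: "s \<in> {\<alpha>..\<beta>}"
  shows "((\<lambda>s. integral {0..1} (\<lambda>z. l s * e (l s * z) s)) has_real_derivative
      integral {0..1} (\<lambda>z. l s * (et (l s * z) s + fx (l s * z) s))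
        - m * e (l s) s - f (l s) s + f 0 s) (at s within {\<alpha>..\<beta>})"
proof -
  have lz: "0 \<le> l r * z \<and> l r * z \<le> 1" if "r \<in> {\<alpha>..\<beta>}" "z \<in> {0..1}" for r z
    using S[OF that(1)] that by (auto intro: mult_le_one)
  have cont: "continuous_on ({\<alpha>..\<beta>} \<times> {0..1}) (\<lambda>z. g (l (fst z) * snd z) (fst z))"
    if "continuous_on ({0..1} \<times> {0..}) (\<lambda>(x, t). g x t)" for g :: "real \<Rightarrow> real \<Rightarrow> real"
    by (rule continuous_on_strip_compose[OF that])
      (use lz S in \<open>auto simp: l_def intro!: continuous_intros\<close>)
  have cont1: "continuous_on {0..1} (\<lambda>z. g (l r * z) r)"
    if "continuous_on ({0..1} \<times> {0..}) (\<lambda>(x, t). g x t)" "r \<in> {\<alpha>..\<beta>}" for g :: "real \<Rightarrow> real \<Rightarrow> real" and r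
    by (rule continuous_on_strip_compose[OF that(1)])
      (use lz S that in \<open>auto intro!: continuous_intros\<close>)
  define D where "D = (\<lambda>r z. - m * e (l r * z) r + l r * (- (m * z) * ex (l r * z) r + et (l r * z) r))"
  have D: "((\<lambda>r. l r * e (l r * z) r) has_real_derivative D r z) (at r within {\<alpha>..\<beta>})"
    if "r \<in> {\<alpha>..\<beta>}" "z \<in> {0..1}" for r z
  proof -
    have "((\<lambda>r. l r * z) has_real_derivative - (m * z)) (at r within {\<alpha>..\<beta>})"
      unfolding l_def by (auto intro!: derivative_eq_intros)
    then have 1: "((\<lambda>r. e (l r * z) r) has_real_derivative - (m * z) * ex (l r * z) r + et (l r * z) r)
        (at r within {\<alpha>..\<beta>})"
      by (rule C1_strip_along_curve[OF e]) (use lz S that in auto)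
    have 2: "(l has_real_derivative - m) (at r within {\<alpha>..\<beta>})"
      unfolding l_def by (auto intro!: derivative_eq_intros)
    show ?thesis
      using DERIV_mult[OF 2 1] by (simp add: D_def algebra_simps)
  qed
  have "((\<lambda>r. integral (cbox 0 1) (\<lambda>z. l r * e (l r * z) r)) has_real_derivative integral (cbox 0 1) (D s))
      (at s within {\<alpha>..\<beta>})"
  proof (rule leibniz_rule_field_derivative)
    show "(\<lambda>z. l r * e (l r * z) r) integrable_on cbox 0 1" if "r \<in> {\<alpha>..\<beta>}" for r
      using cont1[OF C1_stripD(3)[OF e] that] by (auto intro!: integrable_continuous_interval continuous_intros)
    show "continuous_on ({\<alpha>..\<beta>} \<times> cbox 0 1) (\<lambda>(r, z). D r z)"
      unfolding D_def split_beta cbox_interval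
      by (intro continuous_intros cont C1_stripD[OF e])
        (auto simp: l_def split_beta intro!: continuous_intros)
  qed (use D s in auto)
  moreover have "integral {0..1} (D s) = integral {0..1} (\<lambda>z. l s * (et (l s * z) s + fx (l s * z) s))
        - m * e (l s) s - f (l s) s + f 0 s"
  proof -
    \<comment> \<open>\<open>D s\<close> is the production density up to the \<open>z\<close>-derivative \<open>F'\<close> of the boundary terms \<open>F\<close>.\<close>
    define F where "F = (\<lambda>z. - m * (z * e (l s * z) s) - f (l s * z) s)"
    define F' where "F' = (\<lambda>z. - m * (e (l s * z) s + z * (l s * ex (l s * z) s)) - l s * fx (l s * z) s)"
    have "(F has_real_derivative F' z) (at z within {0..1})" if "z \<in> {0..1}" for z
      unfolding F_def F'_def using C1_strip_dilate[OF e _ that] C1_strip_dilate[OF f _ that] S[OF s]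
      by (auto intro!: derivative_eq_intros)
    then have "(F' has_integral F 1 - F 0) {0..1}"
      by (intro fundamental_theorem_of_calculus)
        (auto simp: has_real_derivative_iff_has_vector_derivative)
    moreover have "((\<lambda>z. l s * (et (l s * z) s + fx (l s * z) s)) has_integral
        integral {0..1} (\<lambda>z. l s * (et (l s * z) s + fx (l s * z) s))) {0..1}"
      by (intro integrable_integral integrable_continuous_interval continuous_intros cont1 s
          C1_stripD[OF e] C1_stripD[OF f])
    ultimately have "((\<lambda>z. F' z + l s * (et (l s * z) s + fx (l s * z) s)) has_integral
        F 1 - F 0 + integral {0..1} (\<lambda>z. l s * (et (l s * z) s + fx (l s * z) s))) {0..1}"
      by (rule has_integral_add)
    moreover have "(\<lambda>z. F' z + l s * (et (l s * z) s + fx (l s * z) s)) = D s"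
      by (auto simp: F'_def D_def algebra_simps)
    ultimately show ?thesis
      by (simp add: F_def integral_unique)
  qed
  ultimately show ?thesis
    by simp
qed

section \<open>Classical solutions\<close>

lemma C2_partials_C1_strip:
  assumes "C2_partials v D"
  shows "C1_strip v (D 1 0) (D 0 1)" "C1_strip (D 0 1) (D 1 1) (D 0 2)" "C1_strip (D 1 0) (D 2 0) (D 1 1)"
    and "\<lbrakk>x \<in> {0..1}; t \<ge> 0\<rbrakk> \<Longrightarrow> D 0 0 x t = v x t"
proof -
  note * = assms[unfolded C2_partials_def iterated_partials_def]
  have cont: "continuous_on ({0..1} \<times> {0..}) (\<lambda>(x, t). D \<alpha> \<beta> x t)" if "\<alpha> + \<beta> \<le> 2" for \<alpha> \<beta>
    using * that by blast
  have t: "((\<lambda>s. D 0 \<beta> x s) has_real_derivative D 0 (Suc \<beta>) x t) (at t within {0..})"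
    if "x \<in> {0..1}" "t \<ge> 0" "\<beta> < 2" for x t \<beta>
    using * that by auto
  have x: "((\<lambda>y. D \<alpha> \<beta> y t) has_real_derivative D (Suc \<alpha>) \<beta> x t) (at x within {0..1})"
    if "x \<in> {0..1}" "t \<ge> 0" "\<alpha> + \<beta> < 2" for x t \<alpha> \<beta>
    using * that by auto
  have m: "((\<lambda>s. D 1 0 x s) has_real_derivative D 1 1 x t) (at t within {0..})"
    if "x \<in> {0..1}" "t \<ge> 0" for x t
    using * that by auto
  show 0: "D 0 0 x t = v x t" if "x \<in> {0..1}" "t \<ge> 0" for x t
    using * that by auto
  have "C1_strip (D 0 0) (D 1 0) (D 0 1)"
    unfolding C1_strip_def using x[of _ _ 0 0] t[of _ _ 0] cont[of 0 0] cont[of 1 0] cont[of 0 1] by simp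
  moreover have "continuous_on ({0..1} \<times> {0..}) (\<lambda>(x, t). v x t)"
    using cont[of 0 0] by (rule iffD1[OF continuous_on_cong, rotated -1]) (use 0 in auto)
  moreover have "((\<lambda>s. v x s) has_real_derivative k) (at t within {0..})"
    if "((\<lambda>s. D 0 0 x s) has_real_derivative k) (at t within {0..})" "x \<in> {0..1}" "t \<ge> 0" for x t k
    by (rule has_field_derivative_transform_within[OF that(1) zero_less_one]) (use 0 that in auto)
  moreover have "((\<lambda>y. v y t) has_real_derivative k) (at x within {0..1})"
    if "((\<lambda>y. D 0 0 y t) has_real_derivative k) (at x within {0..1})" "x \<in> {0..1}" "t \<ge> 0" for x t k
    by (rule has_field_derivative_transform_within[OF that(1) zero_less_one]) (use 0 that in auto)
  ultimately show "C1_strip v (D 1 0) (D 0 1)"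
    unfolding C1_strip_def by blast
  show "C1_strip (D 0 1) (D 1 1) (D 0 2)"
    unfolding C1_strip_def using x[of _ _ 0 1] t[of _ _ 1] cont[of 0 1] cont[of 1 1] cont[of 0 2]
    by (simp add: numeral_2_eq_2)
  show "C1_strip (D 1 0) (D 2 0) (D 1 1)"
    unfolding C1_strip_def using x[of _ _ 1 0] m cont[of 1 0] cont[of 1 1] cont[of 2 0]
    by (simp add: numeral_2_eq_2)
qed

text \<open>
  The differential equations hold in the open strip only; continuity carries them to its boundary,
  where they are needed at the end points of the characteristics.
\<close>

lemma strip_interior_dense:
  fixes f :: "real \<Rightarrow> real \<Rightarrow> real"
  assumes "continuous_on ({0..1} \<times> {0..}) (\<lambda>(x, t). f x t)"
    and "\<And>x t. \<lbrakk>x \<in> {0<..<1}; t > 0\<rbrakk> \<Longrightarrow> f x t = 0" and "x \<in> {0..1}" "t \<ge> 0"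
  shows "f x t = 0"
proof -
  have cl: "closure ({0<..<1::real} \<times> {0::real<..}) = {0..1} \<times> {0..}"
    by (simp add: closure_Times)
  have "(case (x, t) of (x, t) \<Rightarrow> f x t) = 0"
    by (rule continuous_constant_on_closure[of "{0<..<1::real} \<times> {0::real<..}"])
      (use assms in \<open>auto simp: cl\<close>)
  then show ?thesis
    by simp
qed

lemma C1_strip_deriv:
  assumes "C1_strip f fx ft" "x \<in> {0<..<1}" "t > 0"
  shows "deriv (\<lambda>s. f x s) t = ft x t" "deriv (\<lambda>y. f y t) x = fx x t"
proof -
  have "at t within {0..} = at t"
    using assms by (intro at_within_interior) (auto simp: interior_real_atLeast)
  then show "deriv (\<lambda>s. f x s) t = ft x t"
    using C1_stripD(2)[OF assms(1), of x t] assms by (auto intro: DERIV_imp_deriv)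
  have "at x within {0..1} = at x"
    using assms by (intro at_within_interior) auto
  then show "deriv (\<lambda>y. f y t) x = fx x t"
    using C1_stripD(1)[OF assms(1), of x t] assms by (auto intro: DERIV_imp_deriv)
qed

lemma C2_partials_diff:
  assumes v: "C2_partials v1 D1" "C2_partials v2 D2"
  shows "C2_partials (\<lambda>x t. v1 x t - v2 x t) (\<lambda>\<alpha> \<beta> x t. D1 \<alpha> \<beta> x t - D2 \<alpha> \<beta> x t)"
proof -
  have "continuous_on ({0..1} \<times> {0..}) (\<lambda>z. D1 \<alpha> \<beta> (fst z) (snd z) - D2 \<alpha> \<beta> (fst z) (snd z))"
    if "\<alpha> + \<beta> \<le> 2" for \<alpha> \<beta>
    using that assms unfolding C2_partials_def split_beta by (intro continuous_on_diff) blast+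
  moreover have "iterated_partials 0 (\<lambda>x t. v1 x t - v2 x t) (\<lambda>\<alpha> \<beta> x t. D1 \<alpha> \<beta> x t - D2 \<alpha> \<beta> x t)"
    using assms unfolding C2_partials_def iterated_partials_def by (simp add: DERIV_diff)
  ultimately show ?thesis
    using assms unfolding C2_partials_def split_beta by (simp add: DERIV_diff)
qed

text \<open>
  The constants in all estimates below are functions of \<open>a\<close>, \<open>p\<close> and \<open>C\<close> alone.
\<close>

locale dissipative_problem =
  fixes a p :: real and c :: "real \<Rightarrow> real \<Rightarrow> real"
    and Dc :: "nat \<Rightarrow> nat \<Rightarrow> real \<Rightarrow> real \<Rightarrow> real" and C :: real
  assumes a: "a > 0" and c: "C2_partials c Dc"
    and Dc_bound: "\<lbrakk>\<alpha> + \<beta> \<le> 2; x \<in> {0..1}; t \<ge> 0\<rbrakk> \<Longrightarrow> \<bar>Dc \<alpha> \<beta> x t\<bar> \<le> C"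
begin

text \<open>
  The derivatives are parameters, so that the difference of two solutions comes with its derivatives; the
  equations are required on the closed strip.
\<close>

definition solution ::
  "(real \<Rightarrow> real \<Rightarrow> real) \<Rightarrow> (real \<Rightarrow> real \<Rightarrow> real) \<Rightarrow> (nat \<Rightarrow> nat \<Rightarrow> real \<Rightarrow> real \<Rightarrow> real) \<Rightarrow>
   (nat \<Rightarrow> nat \<Rightarrow> real \<Rightarrow> real \<Rightarrow> real) \<Rightarrow> bool" where
  "solution w u Dw Du \<longleftrightarrow> C2_partials w Dw \<and> C2_partials u Du \<and>
     (\<forall>x\<in>{0..1}. \<forall>t\<ge>0. Dw 0 1 x t + a * Dw 1 0 x t = u x t \<and>
        Du 0 1 x t - a * Du 1 0 x t = - c x t * w x t) \<and>
     (\<forall>t\<ge>0. w 0 t = p * u 0 t \<and> u 1 t = 0)"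

lemma classical_solution_imp_solution:
  assumes "classical_solution a p c \<phi>1 \<phi>2 w u"
  obtains Dw Du where "solution w u Dw Du"
proof -
  from assms obtain Dw Du where D: "C2_partials w Dw" "C2_partials u Du"
    unfolding classical_solution_def C2_strip_def by blast
  note w = C2_partials_C1_strip(1)[OF D(1)] and u = C2_partials_C1_strip(1)[OF D(2)]
    and c' = C2_partials_C1_strip(1)[OF c]
  note cont = C1_stripD(3-5)[OF w, unfolded split_beta] C1_stripD(3-5)[OF u, unfolded split_beta]
    C1_stripD(3)[OF c', unfolded split_beta]
  have 1: "Dw 0 1 x t + a * Dw 1 0 x t - u x t = 0" if "x \<in> {0..1}" "t \<ge> 0" for x t
  proof (rule strip_interior_dense[OF _ _ that])
    show "continuous_on ({0..1} \<times> {0..}) (\<lambda>(x, t). Dw 0 1 x t + a * Dw 1 0 x t - u x t)"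
      unfolding split_beta by (intro continuous_intros cont)
    show "Dw 0 1 x t + a * Dw 1 0 x t - u x t = 0" if "x \<in> {0<..<1}" "t > 0" for x t
    proof -
      have "deriv (\<lambda>s. w x s) t + a * deriv (\<lambda>y. w y t) x - u x t = 0"
        using assms that unfolding classical_solution_def by blast
      then show ?thesis
        unfolding C1_strip_deriv[OF w that] .
    qed
  qed
  have 2: "Du 0 1 x t - a * Du 1 0 x t + c x t * w x t = 0" if "x \<in> {0..1}" "t \<ge> 0" for x t
  proof (rule strip_interior_dense[OF _ _ that])
    show "continuous_on ({0..1} \<times> {0..}) (\<lambda>(x, t). Du 0 1 x t - a * Du 1 0 x t + c x t * w x t)"
      unfolding split_beta by (intro continuous_intros cont)
    show "Du 0 1 x t - a * Du 1 0 x t + c x t * w x t = 0" if "x \<in> {0<..<1}" "t > 0" for x t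
    proof -
      have "deriv (\<lambda>s. u x s) t - a * deriv (\<lambda>y. u y t) x + c x t * w x t = 0"
        using assms that unfolding classical_solution_def by blast
      then show ?thesis
        unfolding C1_strip_deriv[OF u that] .
    qed
  qed
  have 3: "g t = 0" if "continuous_on {0..} g" "\<And>t. t > 0 \<Longrightarrow> g t = 0" "t \<ge> 0"
    for g :: "real \<Rightarrow> real" and t
    by (rule continuous_constant_on_closure[of "{0::real<..}"]) (use that in auto)
  have trace: "continuous_on {0..} (\<lambda>t. g x t)"
    if "continuous_on ({0..1} \<times> {0..}) (\<lambda>(x, t). g x t)" "x \<in> {0..1}" for g :: "real \<Rightarrow> real \<Rightarrow> real" and x
    by (rule continuous_on_strip_compose[OF that(1)]) (use that in \<open>auto intro: continuous_intros\<close>)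
  have "w 0 t - p * u 0 t = 0" if "t \<ge> 0" for t
    by (rule 3[OF _ _ that])
      (use assms in \<open>auto simp: classical_solution_def
        intro!: continuous_intros trace[OF C1_stripD(3)[OF w]] trace[OF C1_stripD(3)[OF u]]\<close>)
  moreover have "u 1 t = 0" if "t \<ge> 0" for t
    by (rule 3[OF _ _ that])
      (use assms in \<open>auto simp: classical_solution_def intro!: trace[OF C1_stripD(3)[OF u]]\<close>)
  ultimately have "solution w u Dw Du"
    unfolding solution_def using D 1 2 by (auto simp: algebra_simps)
  then show thesis ..
qed

lemma solution_diff:
  assumes "solution w1 u1 Dw1 Du1" "solution w2 u2 Dw2 Du2"
  shows "solution (\<lambda>x t. w1 x t - w2 x t) (\<lambda>x t. u1 x t - u2 x t)
    (\<lambda>\<alpha> \<beta> x t. Dw1 \<alpha> \<beta> x t - Dw2 \<alpha> \<beta> x t) (\<lambda>\<alpha> \<beta> x t. Du1 \<alpha> \<beta> x t - Du2 \<alpha> \<beta> x t)"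
proof -
  have "C2_partials w1 Dw1" "C2_partials w2 Dw2" "C2_partials u1 Du1" "C2_partials u2 Du2"
    using assms by (auto simp: solution_def)
  note C2_partials_diff[OF this(1,2)] C2_partials_diff[OF this(3,4)]
  moreover have "(Dw1 0 1 x t - Dw2 0 1 x t) + a * (Dw1 1 0 x t - Dw2 1 0 x t) = u1 x t - u2 x t"
    "(Du1 0 1 x t - Du2 0 1 x t) - a * (Du1 1 0 x t - Du2 1 0 x t) = - c x t * (w1 x t - w2 x t)"
    if "x \<in> {0..1}" "t \<ge> 0" for x t
  proof -
    have "Dw1 0 1 x t + a * Dw1 1 0 x t = u1 x t" "Dw2 0 1 x t + a * Dw2 1 0 x t = u2 x t"
      "Du1 0 1 x t - a * Du1 1 0 x t = - c x t * w1 x t" "Du2 0 1 x t - a * Du2 1 0 x t = - c x t * w2 x t"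
      using assms that by (simp_all add: solution_def)
    then show "(Dw1 0 1 x t - Dw2 0 1 x t) + a * (Dw1 1 0 x t - Dw2 1 0 x t) = u1 x t - u2 x t"
      "(Du1 0 1 x t - Du2 0 1 x t) - a * (Du1 1 0 x t - Du2 1 0 x t) = - c x t * (w1 x t - w2 x t)"
      unfolding right_diff_distrib by linarith+
  qed
  moreover have "w1 0 t - w2 0 t = p * (u1 0 t - u2 0 t)" "u1 1 t - u2 1 t = 0" if "t \<ge> 0" for t
    using assms that by (simp_all add: solution_def right_diff_distrib)
  ultimately show ?thesis
    unfolding solution_def by blast
qed

end

section \<open>Transport along characteristics\<close>

text \<open>
  Along a characteristic the derivative of \<open>q\<close> is its source, so the mean value inequality applies; it
  takes the place of the integral representation of the solution.
\<close>

lemma transport_along_segment: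
  assumes q: "C1_strip q qx qt" and "s0 \<le> t" and l_def: "l = (\<lambda>s. x - m * (t - s))"
    and S: "\<And>s. s \<in> {s0..t} \<Longrightarrow> l s \<in> {0..1} \<and> 0 \<le> s"
    and R: "\<And>s. s \<in> {s0..t} \<Longrightarrow> \<bar>qt (l s) s + m * qx (l s) s\<bar> \<le> R"
  shows "\<bar>q x t\<bar> \<le> \<bar>q (l s0) s0\<bar> + R * (t - s0)"
proof -
  have d: "((\<lambda>s. q (l s) s) has_real_derivative m * qx (l s) s + qt (l s) s) (at s within {s0..t})"
    if "s \<in> {s0..t}" for s
    by (rule C1_strip_along_curve[OF q _ S that]) (auto simp: l_def intro!: derivative_eq_intros)
  have "\<sigma> * q (l t) t - R * t \<le> \<sigma> * q (l s0) s0 - R * s0" if \<sigma>: "\<sigma> = 1 \<or> \<sigma> = - 1" for \<sigma>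
  proof (rule nonincreasing_of_deriv_nonpos[OF \<open>s0 \<le> t\<close>])
    fix s assume s: "s \<in> {s0..t}"
    show "((\<lambda>s. \<sigma> * q (l s) s - R * s) has_real_derivative \<sigma> * (m * qx (l s) s + qt (l s) s) - R)
        (at s within {s0..t})"
      using d[OF s] by (auto intro!: derivative_eq_intros)
    show "\<sigma> * (m * qx (l s) s + qt (l s) s) - R \<le> 0"
      using R[OF s] \<sigma> by auto
  qed
  from this[of 1] this[of "- 1"] show ?thesis
    by (simp add: l_def algebra_simps abs_le_iff)
qed

text \<open>
  Within time \<open>1 / a\<close> every backward characteristic reaches the inflow end \<open>xb\<close>, so a bound for the
  inflow values and for the source from time \<open>T\<close> on bounds \<open>q\<close> from time \<open>T + 1 / a\<close> on. Since the
  weight \<open>exp (\<omega> * t)\<close> is nondecreasing, bounds at earlier times may be used with the weight at the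
  later time.
\<close>

lemma transport_bound:
  assumes a: "a > (0::real)" and dir: "m = a \<and> xb = 0 \<or> m = - a \<and> xb = 1"
    and q: "C1_strip q qx qt" and "T \<ge> 0" "\<omega> \<ge> 0"
    and B: "\<And>s. s \<ge> T \<Longrightarrow> \<bar>q xb s\<bar> \<le> B * exp (\<omega> * s)"
    and R: "\<And>y s. \<lbrakk>y \<in> {0..1}; s \<ge> T\<rbrakk> \<Longrightarrow> \<bar>qt y s + m * qx y s\<bar> \<le> R * exp (\<omega> * s)"
    and x: "x \<in> {0..1}" and t: "t \<ge> T + 1 / a"
  shows "\<bar>q x t\<bar> \<le> (B + R / a) * exp (\<omega> * t)"
proof -
  have "0 \<le> B * exp (\<omega> * T)" "0 \<le> R * exp (\<omega> * T)"
    using B[of T] R[of 0 T] by force+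
  then have BR: "B \<ge> 0" "R \<ge> 0"
    by (simp_all add: zero_le_mult_iff)
  define s0 where "s0 = t - \<bar>x - xb\<bar> / a"
  define l where "l = (\<lambda>s. x - m * (t - s))"
  have "\<bar>x - xb\<bar> \<le> 1"
    using x dir by auto
  then have len: "0 \<le> t - s0" "t - s0 \<le> 1 / a"
    using a by (auto simp: s0_def divide_right_mono)
  have foot: "l s0 = xb"
    using dir a x by (auto simp: l_def s0_def)
  have "\<bar>q x t\<bar> \<le> \<bar>q (l s0) s0\<bar> + R * exp (\<omega> * t) * (t - s0)"
  proof (rule transport_along_segment[OF q _ l_def])
    fix s assume s: "s \<in> {s0..t}"
    have "a * (t - s0) = \<bar>x - xb\<bar>"
      using a by (simp add: s0_def)
    moreover have "0 \<le> a * (t - s)" "a * (t - s) \<le> a * (t - s0)"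
      using a s by auto
    ultimately show *: "l s \<in> {0..1} \<and> 0 \<le> s"
      using dir x s len t \<open>T \<ge> 0\<close> by (auto simp: l_def)
    have "\<bar>qt (l s) s + m * qx (l s) s\<bar> \<le> R * exp (\<omega> * s)"
      by (rule R) (use * s len t in auto)
    also have "\<dots> \<le> R * exp (\<omega> * t)"
      using s \<open>\<omega> \<ge> 0\<close> BR by (intro mult_left_mono) (auto intro: mult_left_mono)
    finally show "\<bar>qt (l s) s + m * qx (l s) s\<bar> \<le> R * exp (\<omega> * t)" .
  qed (use len in auto)
  also have "\<bar>q (l s0) s0\<bar> \<le> B * exp (\<omega> * s0)"
    unfolding foot by (rule B) (use len t in auto)
  also have "\<dots> \<le> B * exp (\<omega> * t)"
    using len \<open>\<omega> \<ge> 0\<close> BR by (intro mult_left_mono) (auto intro: mult_left_mono)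
  also have "R * exp (\<omega> * t) * (t - s0) \<le> R * exp (\<omega> * t) * (1 / a)"
    using len BR by (intro mult_left_mono) auto
  finally show ?thesis
    by (simp add: algebra_simps)
qed

text \<open>
  Increments from \<open>t\<close> to \<open>t + \<delta>\<close> are estimated below with the weight \<open>exp (\<omega> * (t + \<delta>))\<close> at the later
  time. The resulting factor \<open>exp (\<omega> * \<delta>)\<close> disappears in the limit.
\<close>

lemma abs_deriv_le_of_increments:
  fixes g :: "real \<Rightarrow> real"
  assumes g: "(g has_real_derivative d) (at t within {0..})" and "t \<ge> 0"
    and inc: "\<And>\<delta>. \<delta> > 0 \<Longrightarrow> \<bar>g (t + \<delta>) - g t\<bar> \<le> \<delta> * (K * exp (\<omega> * \<delta>))"
  shows "\<bar>d\<bar> \<le> K"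
proof (rule tendsto_le[of "at_right t"])
  have "((\<lambda>y. (g y - g t) / (y - t)) \<longlongrightarrow> d) (at_right t)"
    using g unfolding has_field_derivative_iff
    by (rule tendsto_within_subset) (use \<open>t \<ge> 0\<close> in auto)
  then show "((\<lambda>y. \<bar>(g y - g t) / (y - t)\<bar>) \<longlongrightarrow> \<bar>d\<bar>) (at_right t)"
    by (rule tendsto_rabs)
  have "((\<lambda>y. K * exp (\<omega> * (y - t))) \<longlongrightarrow> K * exp (\<omega> * (t - t))) (at_right t)"
    by (intro tendsto_intros)
  then show "((\<lambda>y. K * exp (\<omega> * (y - t))) \<longlongrightarrow> K) (at_right t)"
    by simp
  have "\<bar>(g y - g t) / (y - t)\<bar> \<le> K * exp (\<omega> * (y - t))" if "y > t" for y
    using inc[of "y - t"] that by (simp add: divide_le_eq mult.commute)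
  then show "\<forall>\<^sub>F y in at_right t. \<bar>(g y - g t) / (y - t)\<bar> \<le> K * exp (\<omega> * (y - t))"
    by (auto simp: eventually_at_filter)
qed auto

lemma increment_bound:
  fixes g :: "real \<Rightarrow> real"
  assumes g: "\<And>s. s \<ge> 0 \<Longrightarrow> (g has_real_derivative g' s) (at s within {0..})"
    and B: "\<And>s. s \<ge> T \<Longrightarrow> \<bar>g' s\<bar> \<le> B * exp (\<omega> * s)"
    and "T \<ge> 0" "\<omega> \<ge> 0" "s \<ge> T" "\<delta> \<ge> 0"
  shows "\<bar>g (s + \<delta>) - g s\<bar> \<le> \<delta> * B * exp (\<omega> * \<delta>) * exp (\<omega> * s)"
proof -
  have "0 \<le> B * exp (\<omega> * T)"
    using B[of T] by force
  then have "B \<ge> 0"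
    by (simp add: zero_le_mult_iff)
  have "norm (g (s + \<delta>) - g s) \<le> B * exp (\<omega> * (s + \<delta>)) * norm (s + \<delta> - s)"
  proof (rule field_differentiable_bound[of "{s..s + \<delta>}" g g'])
    fix r assume r: "r \<in> {s..s + \<delta>}"
    show "(g has_real_derivative g' r) (at r within {s..s + \<delta>})"
      by (rule DERIV_subset[OF g]) (use r assms in auto)
    have "\<bar>g' r\<bar> \<le> B * exp (\<omega> * r)"
      using B r assms by auto
    also have "\<dots> \<le> B * exp (\<omega> * (s + \<delta>))"
      using r \<open>B \<ge> 0\<close> \<open>\<omega> \<ge> 0\<close> by (intro mult_left_mono) (auto intro!: mult_left_mono)
    finally show "norm (g' r) \<le> B * exp (\<omega> * (s + \<delta>))"
      by simp
  qed (use assms in auto)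
  then show ?thesis
    using \<open>\<delta> \<ge> 0\<close> by (simp add: distrib_left exp_add mult_ac)
qed

text \<open>
  Formally this is \<open>transport_bound\<close> for the time derivative of \<open>q\<close>, which solves the differentiated
  transport equation. But \<open>qt\<close> is merely continuous and cannot be inserted there: the time
  increments of \<open>q\<close> are estimated instead, and divided by their length.
\<close>

lemma transport_time_derivative_bound:
  assumes a: "a > (0::real)" and dir: "m = a \<and> xb = 0 \<or> m = - a \<and> xb = 1"
    and q: "C1_strip q qx qt" and "T \<ge> 0" "\<omega> \<ge> 0"
    and r: "\<And>y s. \<lbrakk>y \<in> {0..1}; s \<ge> 0\<rbrakk> \<Longrightarrow>
      ((\<lambda>s. qt y s + m * qx y s) has_real_derivative rt y s) (at s within {0..})"
    and B: "\<And>s. s \<ge> T \<Longrightarrow> \<bar>qt xb s\<bar> \<le> B * exp (\<omega> * s)"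
    and R: "\<And>y s. \<lbrakk>y \<in> {0..1}; s \<ge> T\<rbrakk> \<Longrightarrow> \<bar>rt y s\<bar> \<le> R * exp (\<omega> * s)"
    and x: "x \<in> {0..1}" and t: "t \<ge> T + 1 / a"
  shows "\<bar>qt x t\<bar> \<le> (B + R / a) * exp (\<omega> * t)"
proof (rule abs_deriv_le_of_increments)
  have "t \<ge> 0"
    using t \<open>T \<ge> 0\<close> a by (smt (verit) divide_pos_pos)
  then show "t \<ge> 0" "((\<lambda>s. q x s) has_real_derivative qt x t) (at t within {0..})"
    using C1_stripD(2)[OF q] x by auto
  fix \<delta> :: real assume "\<delta> > 0"
  have "\<bar>q x (t + \<delta>) - q x t\<bar> \<le> (\<delta> * B * exp (\<omega> * \<delta>) + \<delta> * R * exp (\<omega> * \<delta>) / a) * exp (\<omega> * t)"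
  proof (rule transport_bound[OF a dir C1_strip_diff[OF C1_strip_shift[OF q] q]
        \<open>T \<ge> 0\<close> \<open>\<omega> \<ge> 0\<close> _ _ x t])
    fix s assume s: "s \<ge> T"
    show "\<bar>q xb (s + \<delta>) - q xb s\<bar> \<le> \<delta> * B * exp (\<omega> * \<delta>) * exp (\<omega> * s)"
      by (rule increment_bound[where T = T and g' = "\<lambda>s. qt xb s"])
        (use C1_stripD(2)[OF q, of xb] dir B s \<open>T \<ge> 0\<close> \<open>\<omega> \<ge> 0\<close> \<open>\<delta> > 0\<close> in auto)
    fix y :: real assume y: "y \<in> {0..1}"
    have "\<bar>(qt y (s + \<delta>) + m * qx y (s + \<delta>)) - (qt y s + m * qx y s)\<bar>
        \<le> \<delta> * R * exp (\<omega> * \<delta>) * exp (\<omega> * s)"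
      by (rule increment_bound[where T = T and g = "\<lambda>s. qt y s + m * qx y s" and g' = "\<lambda>s. rt y s"])
        (use r R y s \<open>T \<ge> 0\<close> \<open>\<omega> \<ge> 0\<close> \<open>\<delta> > 0\<close> in auto)
    then show "\<bar>qt y (s + \<delta>) - qt y s + m * (qx y (s + \<delta>) - qx y s)\<bar>
        \<le> \<delta> * R * exp (\<omega> * \<delta>) * exp (\<omega> * s)"
      by (simp add: algebra_simps)
  qed (use \<open>\<delta> > 0\<close> in auto)
  then show "\<bar>q x (t + \<delta>) - q x t\<bar> \<le> \<delta> * ((B + R / a) * exp (\<omega> * t) * exp (\<omega> * \<delta>))"
    by (simp add: algebra_simps)
qed

section \<open>Energy estimates\<close>

context dissipative_problem
begin

lemma C_nonneg: "C \<ge> 0"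
  using Dc_bound[of 0 0 0 0] by simp

text \<open>
  The weight of \<open>u\<close> in the energy exceeds \<open>p\<^sup>2\<close>, so that the reflection \<open>w = p u\<close> at the left end does not
  create energy; it is at least \<open>1\<close>, so that the energy dominates \<open>w\<^sup>2 + u\<^sup>2\<close>.
\<close>

definition \<kappa> :: real where "\<kappa> = p\<^sup>2 + 1"

text \<open>
  The growth rate that the coupling of \<open>w\<close> and \<open>u\<close> can give to the energy, see \<open>energy_production_bound\<close> below.
\<close>

definition \<omega> :: real where "\<omega> = 1 + \<kappa> * C"

definition energy :: "(real \<Rightarrow> real \<Rightarrow> real) \<Rightarrow> (real \<Rightarrow> real \<Rightarrow> real) \<Rightarrow> real \<Rightarrow> real" where
  "energy w u t = integral {0..1} (\<lambda>x. (w x t)\<^sup>2 + \<kappa> * (u x t)\<^sup>2)"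

lemma \<kappa>_ge_1: "\<kappa> \<ge> 1" and \<omega>_nonneg: "\<omega> \<ge> 0"
  using C_nonneg by (auto simp: \<kappa>_def \<omega>_def)

lemma c_bound: "\<lbrakk>x \<in> {0..1}; t \<ge> 0\<rbrakk> \<Longrightarrow> \<bar>c x t\<bar> \<le> C"
  using Dc_bound[of 0 0 x t] C2_partials_C1_strip(4)[OF c, of x t] by simp

lemma energy_production_bound:
  assumes "x \<in> {0..1}" "t \<ge> 0"
  shows "2 * (1 - \<kappa> * c x t) * (y * z) \<le> \<omega> * (y\<^sup>2 + \<kappa> * z\<^sup>2)"
proof -
  have "\<bar>\<kappa> * c x t\<bar> \<le> \<kappa> * C"
    using c_bound[OF assms] \<kappa>_ge_1 by (simp add: abs_mult)
  then have "\<bar>1 - \<kappa> * c x t\<bar> \<le> \<omega>"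
    by (simp add: \<omega>_def)
  moreover have "2 * \<bar>y * z\<bar> \<le> y\<^sup>2 + z\<^sup>2"
    using sum_squares_bound[of "\<bar>y\<bar>" "\<bar>z\<bar>"] by (simp add: abs_mult)
  moreover have "z\<^sup>2 \<le> \<kappa> * z\<^sup>2"
    using \<kappa>_ge_1 mult_right_mono[of 1 \<kappa> "z\<^sup>2"] by simp
  ultimately have "\<bar>1 - \<kappa> * c x t\<bar> * (2 * \<bar>y * z\<bar>) \<le> \<omega> * (y\<^sup>2 + \<kappa> * z\<^sup>2)"
    using \<omega>_nonneg by (intro mult_mono) auto
  moreover have "2 * (1 - \<kappa> * c x t) * (y * z) \<le> \<bar>1 - \<kappa> * c x t\<bar> * (2 * \<bar>y * z\<bar>)"
  proof -
    have "(1 - \<kappa> * c x t) * (2 * (y * z)) \<le> \<bar>(1 - \<kappa> * c x t) * (2 * (y * z))\<bar>"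
      by (rule abs_ge_self)
    also have "\<dots> = \<bar>1 - \<kappa> * c x t\<bar> * (2 * \<bar>y * z\<bar>)"
      by (simp only: abs_mult abs_numeral)
    finally show ?thesis
      by (simp only: mult_ac)
  qed
  ultimately show ?thesis
    by linarith
qed

text \<open>
  The density \<open>w\<^sup>2 + \<kappa> u\<^sup>2\<close> has the flux \<open>a (w\<^sup>2 - \<kappa> u\<^sup>2)\<close>, because \<open>w\<close> moves to the right and \<open>u\<close> to the left.
  The flux through \<open>x = 0\<close> is at most zero by the choice of \<open>\<kappa>\<close>. Of the two speeds of the endpoint that are
  used, \<open>m = 0\<close> gives the growth of the total energy; for \<open>m = a\<close>, when the endpoint moves along a leftward
  characteristic, the \<open>u\<^sup>2\<close> terms cancel and \<open>- 2 a w\<^sup>2\<close> remains.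
\<close>

lemma localized_energy_derivative:
  assumes sol: "solution w u Dw Du" and l_def: "l = (\<lambda>s. b - m * s)"
    and S: "\<And>s. s \<in> {\<alpha>..\<beta>} \<Longrightarrow> l s \<in> {0..1} \<and> 0 \<le> s" and s: "s \<in> {\<alpha>..\<beta>}"
  defines "G \<equiv> \<lambda>s. integral {0..1} (\<lambda>z. l s * ((w (l s * z) s)\<^sup>2 + \<kappa> * (u (l s * z) s)\<^sup>2))"
  obtains G' where "(G has_real_derivative G') (at s within {\<alpha>..\<beta>})"
    and "G' \<le> \<omega> * G s - m * ((w (l s) s)\<^sup>2 + \<kappa> * (u (l s) s)\<^sup>2) - a * ((w (l s) s)\<^sup>2 - \<kappa> * (u (l s) s)\<^sup>2)"
proof -
  have w: "C1_strip w (Dw 1 0) (Dw 0 1)" and u: "C1_strip u (Du 1 0) (Du 0 1)"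
    using sol C2_partials_C1_strip(1) by (auto simp: solution_def)
  note w2 = C1_strip_mult[OF w w] and u2 = C1_strip_cmult[OF C1_strip_mult[OF u u], of \<kappa>]
  note e = C1_strip_add[OF w2 u2] and f = C1_strip_cmult[OF C1_strip_diff[OF w2 u2], of a]
  let ?\<sigma> = "\<lambda>y. l s * (2 * (1 - \<kappa> * c y s) * (w y s * u y s))"
  have ls: "0 \<le> l s" "0 \<le> s" and lz: "l s * z \<in> {0..1}" if "z \<in> {0..1}" for z
    using S[OF s] that by (auto intro: mult_le_one)
  have \<sigma>: "l s * ((Dw 0 1 y s * w y s + w y s * Dw 0 1 y s + \<kappa> * (Du 0 1 y s * u y s + u y s * Du 0 1 y s))
      + a * (Dw 1 0 y s * w y s + w y s * Dw 1 0 y s - \<kappa> * (Du 1 0 y s * u y s + u y s * Du 1 0 y s)))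
      = ?\<sigma> y" if "y \<in> {0..1}" for y
  proof -
    have 1: "Dw 0 1 y s = u y s - a * Dw 1 0 y s" "Du 0 1 y s = a * Du 1 0 y s - c y s * w y s"
      using sol that ls[of 0] by (auto simp: solution_def algebra_simps)
    show ?thesis
      unfolding 1 by (simp add: algebra_simps)
  qed
  have cont: "continuous_on {0..1} (\<lambda>z. g (l s * z) s)"
    if "continuous_on ({0..1} \<times> {0..}) (\<lambda>(x, t). g x t)" for g :: "real \<Rightarrow> real \<Rightarrow> real"
    by (rule continuous_on_strip_compose[OF that])
      (use lz ls[of 0] in \<open>auto intro!: continuous_intros\<close>)
  note conts = cont[OF C1_stripD(3)[OF w]] cont[OF C1_stripD(3)[OF u]]
    cont[OF C1_stripD(3)[OF C2_partials_C1_strip(1)[OF c]]]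
  define G' where "G' = integral {0..1} (\<lambda>z. ?\<sigma> (l s * z))
    - m * ((w (l s) s)\<^sup>2 + \<kappa> * (u (l s) s)\<^sup>2) - a * ((w (l s) s)\<^sup>2 - \<kappa> * (u (l s) s)\<^sup>2)
    + a * ((w 0 s)\<^sup>2 - \<kappa> * (u 0 s)\<^sup>2)"
  have "integral {0..1} (\<lambda>z. ?\<sigma> (l s * z)) \<le>
      integral {0..1} (\<lambda>z. \<omega> * (l s * ((w (l s * z) s)\<^sup>2 + \<kappa> * (u (l s * z) s)\<^sup>2)))"
  proof (rule integral_le)
    show "?\<sigma> (l s * z) \<le> \<omega> * (l s * ((w (l s * z) s)\<^sup>2 + \<kappa> * (u (l s * z) s)\<^sup>2))"
      if "z \<in> {0..1}" for z
      using mult_left_mono[OF energy_production_bound[OF lz[OF that] ls(2)[OF that],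
            where y = "w (l s * z) s" and z = "u (l s * z) s"] ls(1)[OF that]]
      by (simp add: mult_ac)
  qed (intro integrable_continuous_interval continuous_intros conts)+
  moreover have "(w 0 s)\<^sup>2 \<le> \<kappa> * (u 0 s)\<^sup>2"
    using sol ls(2)[of 0] by (auto simp: solution_def \<kappa>_def power_mult_distrib algebra_simps)
  then have "a * ((w 0 s)\<^sup>2 - \<kappa> * (u 0 s)\<^sup>2) \<le> 0"
    using a by (simp add: mult_le_0_iff)
  ultimately have "G' \<le> \<omega> * G s - m * ((w (l s) s)\<^sup>2 + \<kappa> * (u (l s) s)\<^sup>2)
      - a * ((w (l s) s)\<^sup>2 - \<kappa> * (u (l s) s)\<^sup>2)"
    by (simp add: G'_def G_def)
  moreover have "integral {0..1} (\<lambda>z. l s * ((Dw 0 1 (l s * z) s * w (l s * z) s + w (l s * z) s * Dw 0 1 (l s * z) s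
        + \<kappa> * (Du 0 1 (l s * z) s * u (l s * z) s + u (l s * z) s * Du 0 1 (l s * z) s))
      + a * (Dw 1 0 (l s * z) s * w (l s * z) s + w (l s * z) s * Dw 1 0 (l s * z) s
        - \<kappa> * (Du 1 0 (l s * z) s * u (l s * z) s + u (l s * z) s * Du 1 0 (l s * z) s))))
      = integral {0..1} (\<lambda>z. ?\<sigma> (l s * z))"
    by (intro integral_cong \<sigma> lz)
  then have "(G has_real_derivative G') (at s within {\<alpha>..\<beta>})"
    using moving_domain_balance[OF e f l_def S s] by (simp add: G_def G'_def power2_eq_square algebra_simps)
  ultimately show thesis
    using that by blast
qed

lemma energy_growth:
  assumes sol: "solution w u Dw Du" and "t \<ge> 0"
  shows "energy w u t \<le> exp (\<omega> * t) * energy w u 0"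
proof -
  have "exp (- \<omega> * t) * energy w u t \<le> exp (- \<omega> * 0) * energy w u 0"
  proof -
    have "\<exists>d. ((\<lambda>s. exp (- \<omega> * s) * energy w u s) has_real_derivative d) (at s within {0..t}) \<and> d \<le> 0"
      if s: "s \<in> {0..t}" for s
    proof -
      obtain E' where E': "((\<lambda>s. energy w u s) has_real_derivative E') (at s within {0..t})"
        "E' \<le> \<omega> * energy w u s - a * ((w 1 s)\<^sup>2 - \<kappa> * (u 1 s)\<^sup>2)"
        using localized_energy_derivative[OF sol, of "\<lambda>s. 1 - 0 * s" 1 0 0 t s] s
        by (auto simp: energy_def)
      have "u 1 s = 0"
        using sol s by (simp add: solution_def)
      then have "0 \<le> a * ((w 1 s)\<^sup>2 - \<kappa> * (u 1 s)\<^sup>2)"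
        using a by simp
      then have "E' - \<omega> * energy w u s \<le> 0"
        using E'(2) by linarith
      then have "exp (- \<omega> * s) * (E' - \<omega> * energy w u s) \<le> 0"
        by (simp add: mult_le_0_iff)
      moreover have "((\<lambda>s. exp (- \<omega> * s) * energy w u s) has_real_derivative
          exp (- \<omega> * s) * (E' - \<omega> * energy w u s)) (at s within {0..t})"
        using E'(1) by (auto intro!: derivative_eq_intros simp: algebra_simps)
      ultimately show ?thesis
        by blast
    qed
    then obtain d where "\<And>s. s \<in> {0..t} \<Longrightarrow>
        ((\<lambda>s. exp (- \<omega> * s) * energy w u s) has_real_derivative d s) (at s within {0..t}) \<and> d s \<le> 0"
      by metis
    then show ?thesis
      using nonincreasing_of_deriv_nonpos[OF \<open>t \<ge> 0\<close>, of "\<lambda>s. exp (- \<omega> * s) * energy w u s" d] by blast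
  qed
  then show ?thesis
    by (simp add: exp_minus field_simps)
qed

text \<open>
  Along the leftward characteristic through \<open>(x, t)\<close>, which starts at \<open>x = 1\<close> with \<open>u = 0\<close>, the rate of
  change of \<open>u\<close> is \<open>- c w\<close>, and the integral of \<open>w\<^sup>2\<close> along it is controlled by the energy \<open>G\<close> to the left
  of it. The Cauchy-Schwarz step is done pointwise, in the form \<open>2 K \<bar>w\<bar> \<le> K\<^sup>2 + w\<^sup>2\<close> with a constant \<open>K\<close>
  of the size of the expected bound: the function \<open>\<Lambda>\<close> of the proof decreases along the characteristic.
\<close>

lemma u_sup_bound:
  assumes sol: "solution w u Dw Du" and E0: "energy w u 0 \<le> N\<^sup>2" and N: "N > 0"
    and x: "x \<in> {0..1}" and t: "t \<ge> 1 / a"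
  shows "\<bar>u x t\<bar> \<le> C / a * N * exp (\<omega> * t)"
proof -
  have u: "C1_strip u (Du 1 0) (Du 0 1)"
    using sol C2_partials_C1_strip(1) by (auto simp: solution_def)
  define s0 where "s0 = t - (1 - x) / a"
  define l where "l = (\<lambda>s. (x + a * t) - a * s)"
  define G where "G = (\<lambda>s. integral {0..1} (\<lambda>z. l s * ((w (l s * z) s)\<^sup>2 + \<kappa> * (u (l s * z) s)\<^sup>2)))"
  define K where "K = N * exp (\<omega> * t)"
  have K: "K > 0"
    using N by (simp add: K_def)
  have "(1 - x) / a \<le> 1 / a"
    using x a by (intro divide_right_mono) auto
  then have s0: "0 \<le> s0" "s0 \<le> t" "t - s0 \<le> 1 / a"
    using x a t by (auto simp: s0_def)
  have l0: "l s0 = 1" and lt: "l t = x"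
    using a by (auto simp: l_def s0_def field_simps)
  have S: "l s \<in> {0..1} \<and> 0 \<le> s" if "s \<in> {s0..t}" for s
  proof -
    have "a * s0 \<le> a * s" "a * s \<le> a * t"
      using that a by auto
    then have "l t \<le> l s" "l s \<le> l s0"
      by (auto simp: l_def)
    then show ?thesis
      using that s0 x l0 lt by auto
  qed
  have G0: "G s0 \<le> exp (\<omega> * s0) * N\<^sup>2"
  proof -
    have "G s0 = energy w u s0"
      by (simp add: G_def l0 energy_def)
    also have "\<dots> \<le> exp (\<omega> * s0) * energy w u 0"
      by (rule energy_growth[OF sol s0(1)])
    also have "\<dots> \<le> exp (\<omega> * s0) * N\<^sup>2"
      by (rule mult_left_mono[OF E0]) simp
    finally show ?thesis .
  qed
  have Gt: "G t \<ge> 0"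
  proof -
    have "0 \<le> l t * ((w (l t * z) t)\<^sup>2 + \<kappa> * (u (l t * z) t)\<^sup>2)" for z
      using S[of t] s0 \<kappa>_ge_1 by auto
    then show ?thesis
      unfolding G_def by (metis (no_types, lifting) integral_nonneg not_integrable_integral order_refl)
  qed
  have "\<sigma> * u x t \<le> C / a * N * exp (\<omega> * t)" if \<sigma>: "\<sigma> = 1 \<or> \<sigma> = - 1" for \<sigma>
  proof -
    \<comment> \<open>With this coefficient the loss of energy contributes \<open>- C w\<^sup>2 / (2 K)\<close> to the derivative of \<open>\<Lambda>\<close>.\<close>
    define A where "A = C / (4 * a * K)"
    have A: "A \<ge> 0"
      using C_nonneg a K by (simp add: A_def)
    define \<Lambda> where "\<Lambda> = (\<lambda>s. \<sigma> * u (l s) s - C * K / 2 * s + A * (exp (\<omega> * (t - s)) * G s))"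
    have "\<exists>d. (\<Lambda> has_real_derivative d) (at s within {s0..t}) \<and> d \<le> 0" if s: "s \<in> {s0..t}" for s
    proof -
      obtain G' where G': "(G has_real_derivative G') (at s within {s0..t})"
        "G' \<le> \<omega> * G s - a * ((w (l s) s)\<^sup>2 + \<kappa> * (u (l s) s)\<^sup>2) - a * ((w (l s) s)\<^sup>2 - \<kappa> * (u (l s) s)\<^sup>2)"
        using localized_energy_derivative[OF sol l_def S s] unfolding G_def by blast
      let ?w = "w (l s) s"
      have "((\<lambda>s. u (l s) s) has_real_derivative - a * Du 1 0 (l s) s + Du 0 1 (l s) s) (at s within {s0..t})"
        by (rule C1_strip_along_curve[OF u _ S s]) (auto simp: l_def intro!: derivative_eq_intros)
      also have "- a * Du 1 0 (l s) s + Du 0 1 (l s) s = - c (l s) s * ?w"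
        using sol S[OF s] by (auto simp: solution_def algebra_simps)
      finally have U: "((\<lambda>s. u (l s) s) has_real_derivative - c (l s) s * ?w) (at s within {s0..t})" .
      have d: "(\<Lambda> has_real_derivative \<sigma> * (- c (l s) s * ?w) - C * K / 2
          + A * (exp (\<omega> * (t - s)) * (G' - \<omega> * G s))) (at s within {s0..t})"
        unfolding \<Lambda>_def using U G'(1) by (auto intro!: derivative_eq_intros simp: algebra_simps)
      have "\<bar>c (l s) s\<bar> * \<bar>?w\<bar> \<le> C * \<bar>?w\<bar>"
        using c_bound[of "l s" s] S[OF s] by (intro mult_right_mono) auto
      moreover have "\<sigma> * (- c (l s) s * ?w) \<le> \<bar>c (l s) s\<bar> * \<bar>?w\<bar>"
        using \<sigma> abs_ge_self[of "c (l s) s * ?w"] abs_ge_minus_self[of "c (l s) s * ?w"]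
        by (auto simp: abs_mult)
      moreover have "A * (exp (\<omega> * (t - s)) * (G' - \<omega> * G s)) \<le> A * (- 2 * a * ?w\<^sup>2)"
      proof (rule mult_left_mono)
        have "G' - \<omega> * G s \<le> - 2 * a * ?w\<^sup>2"
          using G'(2) by (simp add: algebra_simps)
        then have "exp (\<omega> * (t - s)) * (G' - \<omega> * G s) \<le> exp (\<omega> * (t - s)) * (- 2 * a * ?w\<^sup>2)"
          by (rule mult_left_mono) simp
        also have "1 * (2 * a * ?w\<^sup>2) \<le> exp (\<omega> * (t - s)) * (2 * a * ?w\<^sup>2)"
          using s \<omega>_nonneg a by (intro mult_right_mono) auto
        then have "exp (\<omega> * (t - s)) * (- 2 * a * ?w\<^sup>2) \<le> - 2 * a * ?w\<^sup>2"
          by simp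
        finally show "exp (\<omega> * (t - s)) * (G' - \<omega> * G s) \<le> - 2 * a * ?w\<^sup>2" .
      qed (rule A)
      moreover have "C * \<bar>?w\<bar> - C * K / 2 + A * (- 2 * a * ?w\<^sup>2) = - C / (2 * K) * (K - \<bar>?w\<bar>)\<^sup>2"
        using a K by (simp add: A_def field_simps power2_eq_square)
      moreover have "- C / (2 * K) * (K - \<bar>?w\<bar>)\<^sup>2 \<le> 0"
        using C_nonneg K by (intro mult_nonpos_nonneg) (auto simp: divide_nonpos_pos)
      ultimately show ?thesis
        using d by (intro exI conjI) (assumption, linarith)
    qed
    then obtain d where "\<And>s. s \<in> {s0..t} \<Longrightarrow> (\<Lambda> has_real_derivative d s) (at s within {s0..t}) \<and> d s \<le> 0"
      by metis
    then have "\<Lambda> t \<le> \<Lambda> s0"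
      using nonincreasing_of_deriv_nonpos[OF s0(2), of \<Lambda> d] by blast
    moreover have "0 \<le> A * G t"
      using A Gt by auto
    moreover have "u 1 s0 = 0"
      using sol s0 by (simp add: solution_def)
    moreover have "A * (exp (\<omega> * (t - s0)) * G s0) \<le> C / (4 * a) * K"
    proof -
      have "exp (\<omega> * (t - s0)) * G s0 \<le> exp (\<omega> * (t - s0)) * (exp (\<omega> * s0) * N\<^sup>2)"
        by (rule mult_left_mono[OF G0]) simp
      also have "\<dots> = exp (\<omega> * t) * N\<^sup>2"
        by (simp add: exp_add[symmetric] algebra_simps flip: mult.assoc)
      also have "\<dots> \<le> (exp (\<omega> * t) * exp (\<omega> * t)) * N\<^sup>2"
        using \<omega>_nonneg s0 by (intro mult_right_mono) auto
      also have "\<dots> = K * K"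
        by (simp add: K_def power2_eq_square)
      finally have "A * (exp (\<omega> * (t - s0)) * G s0) \<le> A * (K * K)"
        by (rule mult_left_mono) (rule A)
      also have "\<dots> = C / (4 * a) * K"
        using K a by (simp add: A_def field_simps)
      finally show ?thesis .
    qed
    moreover have "C * K / 2 * (t - s0) \<le> C * K / 2 * (1 / a)"
      using C_nonneg K s0 by (intro mult_left_mono) auto
    moreover have "0 \<le> C / a * K"
      using C_nonneg a K by auto
    ultimately have "\<sigma> * u x t \<le> C / a * K"
      unfolding \<Lambda>_def by (simp add: l0 lt algebra_simps)
    then show ?thesis
      by (simp add: K_def mult_ac)
  qed
  from this[of 1] this[of "- 1"] show ?thesis
    by simp
qed

end

section \<open>Gain of derivatives\<close>

lemma abs_mult_le: "\<lbrakk>\<bar>y\<bar> \<le> A; \<bar>z\<bar> \<le> B\<rbrakk> \<Longrightarrow> \<bar>y * z\<bar> \<le> A * (B :: real)"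
  by (simp add: abs_mult mult_mono')

context dissipative_problem
begin

text \<open>
  Both orders of the mixed derivative matter here: \<open>D 1 1\<close> is the time derivative of \<open>D 1 0\<close> when the
  equations are differentiated in time, and the space derivative of \<open>D 0 1\<close> when the first one is
  differentiated in space.
\<close>

lemma solution_differentiated:
  assumes sol: "solution w u Dw Du" and xt: "x \<in> {0..1}" "t \<ge> 0"
  shows "Dw 0 2 x t + a * Dw 1 1 x t = Du 0 1 x t"
    and "Du 0 2 x t - a * Du 1 1 x t = - (Dc 0 1 x t * w x t + c x t * Dw 0 1 x t)"
    and "Dw 1 1 x t + a * Dw 2 0 x t = Du 1 0 x t"
    and "Dw 0 1 0 t = p * Du 0 1 0 t" "Dw 0 2 0 t = p * Du 0 2 0 t"
    and "Du 0 1 1 t = 0" "Du 0 2 1 t = 0"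
proof -
  have D: "C2_partials w Dw" "C2_partials u Du"
    using sol by (auto simp: solution_def)
  note w = C2_partials_C1_strip(1)[OF D(1)] and wt = C2_partials_C1_strip(2)[OF D(1)]
    and wx = C2_partials_C1_strip(3)[OF D(1)]
  note u = C2_partials_C1_strip(1)[OF D(2)] and ut = C2_partials_C1_strip(2)[OF D(2)]
    and ux = C2_partials_C1_strip(3)[OF D(2)]
  note c' = C2_partials_C1_strip(1)[OF c]
  have t_unique: "d1 = d2"
    if "(f has_real_derivative d1) (at s within {0..})" "(g has_real_derivative d2) (at s within {0..})"
      and "\<And>r. r \<ge> 0 \<Longrightarrow> f r = g r" and "s \<ge> 0" for f g :: "real \<Rightarrow> real" and d1 d2 s
  proof (rule vector_derivative_unique_within)
    show "at s within {0..} \<noteq> bot"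
      using \<open>s \<ge> 0\<close> islimpt_subset[of s "{s..s + 1}" "{0..}"]
      by (auto simp: trivial_limit_within)
    show "(f has_vector_derivative d1) (at s within {0..})"
      using that(1) by (simp add: has_real_derivative_iff_has_vector_derivative)
    have "(f has_real_derivative d2) (at s within {0..})"
      by (rule has_field_derivative_transform_within[OF that(2) zero_less_one]) (use that in auto)
    then show "(f has_vector_derivative d2) (at s within {0..})"
      by (simp add: has_real_derivative_iff_has_vector_derivative)
  qed
  have x_unique: "d1 = d2"
    if "(f has_real_derivative d1) (at x within {0..1})" "(g has_real_derivative d2) (at x within {0..1})"
      and "\<And>r. r \<in> {0..1} \<Longrightarrow> f r = g r" for f g :: "real \<Rightarrow> real" and d1 d2
  proof (rule vector_derivative_unique_within)
    show "at x within {0..1} \<noteq> bot"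
      using xt by (auto simp: trivial_limit_within)
    show "(f has_vector_derivative d1) (at x within {0..1})"
      using that(1) by (simp add: has_real_derivative_iff_has_vector_derivative)
    have "(f has_real_derivative d2) (at x within {0..1})"
      by (rule has_field_derivative_transform_within[OF that(2) zero_less_one]) (use that xt in auto)
    then show "(f has_vector_derivative d2) (at x within {0..1})"
      by (simp add: has_real_derivative_iff_has_vector_derivative)
  qed
  have eq: "Dw 0 1 y s + a * Dw 1 0 y s = u y s" "Du 0 1 y s - a * Du 1 0 y s = - (c y s * w y s)"
    if "y \<in> {0..1}" "s \<ge> 0" for y s
    using sol that by (auto simp: solution_def)
  have bd: "w 0 s = p * u 0 s" "u 1 s = 0" if "s \<ge> 0" for s
    using sol that by (auto simp: solution_def)
  have x: "0 \<le> x" "x \<le> 1"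
    using xt by auto
  show "Dw 0 2 x t + a * Dw 1 1 x t = Du 0 1 x t"
    by (rule t_unique[OF DERIV_add[OF C1_stripD(2)[OF wt x xt(2)] DERIV_cmult[OF C1_stripD(2)[OF wx x xt(2)]]]
          C1_stripD(2)[OF u x xt(2)] eq(1)[OF xt(1)] xt(2)])
  have "Du 0 2 x t - a * Du 1 1 x t = - (Dc 0 1 x t * w x t + Dw 0 1 x t * c x t)"
    by (rule t_unique[OF DERIV_diff[OF C1_stripD(2)[OF ut x xt(2)] DERIV_cmult[OF C1_stripD(2)[OF ux x xt(2)]]]
          DERIV_minus[OF DERIV_mult[OF C1_stripD(2)[OF c' x xt(2)] C1_stripD(2)[OF w x xt(2)]]] eq(2)[OF xt(1)] xt(2)])
  then show "Du 0 2 x t - a * Du 1 1 x t = - (Dc 0 1 x t * w x t + c x t * Dw 0 1 x t)"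
    by (simp add: mult.commute)
  show "Dw 1 1 x t + a * Dw 2 0 x t = Du 1 0 x t"
    by (rule x_unique[OF DERIV_add[OF C1_stripD(1)[OF wt x xt(2)] DERIV_cmult[OF C1_stripD(1)[OF wx x xt(2)]]]
          C1_stripD(1)[OF u x xt(2)] eq(1)[OF _ xt(2)]])
  have wt0: "Dw 0 1 0 s = p * Du 0 1 0 s" if "s \<ge> 0" for s
    by (rule t_unique[OF C1_stripD(2)[OF w _ _ that] DERIV_cmult[OF C1_stripD(2)[OF u _ _ that]] bd(1) that]) auto
  then show "Dw 0 1 0 t = p * Du 0 1 0 t"
    using xt by blast
  show "Dw 0 2 0 t = p * Du 0 2 0 t"
    by (rule t_unique[OF C1_stripD(2)[OF wt _ _ xt(2)] DERIV_cmult[OF C1_stripD(2)[OF ut _ _ xt(2)]] wt0 xt(2)]) auto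
  have ut1: "Du 0 1 1 s = 0" if "s \<ge> 0" for s
    by (rule t_unique[OF C1_stripD(2)[OF u _ _ that] DERIV_const bd(2) that]) auto
  then show "Du 0 1 1 t = 0"
    using xt by blast
  show "Du 0 2 1 t = 0"
    by (rule t_unique[OF C1_stripD(2)[OF ut _ _ xt(2)] DERIV_const ut1 xt(2)]) auto
qed

text \<open>
  The bootstrap: \<open>K1\<close>, \<open>K3\<close>, \<open>K5\<close> bound \<open>u\<close>, \<open>u\<^sub>t\<close>, \<open>u\<^sub>t\<^sub>t\<close> from the times \<open>1 / a\<close>, \<open>3 / a\<close>, \<open>5 / a\<close> on, and
  \<open>K2\<close>, \<open>K4\<close>, \<open>K6\<close> bound \<open>w\<close>, \<open>w\<^sub>t\<close>, \<open>w\<^sub>t\<^sub>t\<close> from \<open>2 / a\<close>, \<open>4 / a\<close>, \<open>6 / a\<close> on. The bounds for \<open>w\<close> and its time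
  derivatives follow from those for \<open>u\<close> by transport from \<open>x = 0\<close>. Those for \<open>u\<^sub>t\<close> and \<open>u\<^sub>t\<^sub>t\<close> are
  obtained from \<open>q = u\<^sub>t + c w / 2\<close> and \<open>q\<^sub>t\<close> (bounded by \<open>Q3\<close> and \<open>Q5\<close>) by transport from \<open>x = 1\<close>. All constants
  depend on \<open>a\<close>, \<open>p\<close> and \<open>C\<close> only.
\<close>

lemma derivative_bounds:
  obtains K where "K \<ge> 0" and
    "\<And>w u Dw Du N \<alpha> \<beta> x t. \<lbrakk>solution w u Dw Du; energy w u 0 \<le> N\<^sup>2; N > 0; \<alpha> + \<beta> \<le> 2;
      x \<in> {0..1}; t \<ge> 6 / a\<rbrakk> \<Longrightarrow> \<bar>Dw \<alpha> \<beta> x t\<bar> \<le> K * N * exp (\<omega> * t)"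
proof -
  define K1 where "K1 = C / a"
  define K2 where "K2 = \<bar>p\<bar> * K1 + K1 / a"
  define Q3 where "Q3 = C * K2 / 2 + (1 / 2 * ((C + a * C) * K2 + C * K1)) / a"
  define K3 where "K3 = Q3 + C * K2 / 2"
  define K4 where "K4 = \<bar>p\<bar> * K3 + K3 / a"
  define Q5 where "Q5 = (C * K2 + C * K4) / 2
    + (1 / 2 * ((C + a * C) * K2 + (C + a * C) * K4 + (C * K1 + C * K3))) / a"
  define K5 where "K5 = Q5 + (C * K2 + C * K4) / 2"
  define K6 where "K6 = \<bar>p\<bar> * K5 + K5 / a"
  define X10 where "X10 = (K1 + K4) / a"
  define X11 where "X11 = (K3 + K6) / a"
  define X20 where "X20 = ((K3 + C * K2) / a + X11) / a"
  note C0 = C_nonneg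
  have nonneg: "0 \<le> K1" "0 \<le> K2" "0 \<le> Q3" "0 \<le> K3" "0 \<le> K4" "0 \<le> Q5" "0 \<le> K5" "0 \<le> K6"
    "0 \<le> X10" "0 \<le> X11" "0 \<le> X20"
    unfolding K1_def K2_def Q3_def K3_def K4_def Q5_def K5_def K6_def X10_def X11_def X20_def
    using a C0 by (auto intro!: add_nonneg_nonneg mult_nonneg_nonneg divide_nonneg_nonneg)
  define K where "K = K2 + K4 + K6 + X10 + X11 + X20"
  have main: "\<bar>Dw \<alpha> \<beta> x t\<bar> \<le> K * N * exp (\<omega> * t)"
    if sol: "solution w u Dw Du" and E: "energy w u 0 \<le> N\<^sup>2" and N: "N > 0"
      and \<alpha>\<beta>: "\<alpha> + \<beta> \<le> 2" and x: "x \<in> {0..1}" and t: "t \<ge> 6 / a" for w u Dw Du N \<alpha> \<beta> x t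
  proof -
    define e where "e = (\<lambda>s. N * exp (\<omega> * s))"
    have e0: "0 \<le> e s" for s
      using N by (simp add: e_def)
    have D: "C2_partials w Dw" "C2_partials u Du"
      using sol by (auto simp: solution_def)
    note w' = C2_partials_C1_strip(1)[OF D(1)] and wt' = C2_partials_C1_strip(2)[OF D(1)]
    note u' = C2_partials_C1_strip(1)[OF D(2)] and ut' = C2_partials_C1_strip(2)[OF D(2)]
    note c' = C2_partials_C1_strip(1)[OF c] and ct' = C2_partials_C1_strip(2)[OF c]
      and cx' = C2_partials_C1_strip(3)[OF c]
    have eq: "Dw 0 1 y s + a * Dw 1 0 y s = u y s" "Du 0 1 y s - a * Du 1 0 y s = - (c y s * w y s)"
      if "y \<in> {0..1}" "s \<ge> 0" for y s
      using sol that by (auto simp: solution_def)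
    have bd: "w 0 s = p * u 0 s" "u 1 s = 0" if "s \<ge> 0" for s
      using sol that by (auto simp: solution_def)
    note deq = solution_differentiated[OF sol]
    have time: "0 \<le> s \<and> j / a \<le> s" if "s \<ge> k / a" "0 \<le> k" "j \<le> k" for s k j
    proof -
      have "0 \<le> k / a" "j / a \<le> k / a"
        using that a by (auto simp: divide_right_mono)
      then show ?thesis
        using that by linarith
    qed

    have u: "\<bar>u y s\<bar> \<le> K1 * e s" if "y \<in> {0..1}" "s \<ge> 1 / a" for y s
      using u_sup_bound[OF sol E N that] by (simp add: K1_def e_def)

    have w: "\<bar>w y s\<bar> \<le> K2 * e s" if y: "y \<in> {0..1}" and s: "s \<ge> 2 / a" for y s
    proof -
      have "\<bar>w y s\<bar> \<le> (\<bar>p\<bar> * K1 * N + K1 * N / a) * exp (\<omega> * s)"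
      proof (rule transport_bound[OF a _ w' _ \<omega>_nonneg _ _ y])
        show "a = a \<and> (0::real) = 0 \<or> a = - a \<and> (0::real) = 1" "0 \<le> 1 / a" "1 / a + 1 / a \<le> s"
          using a s by auto
        fix r assume r: "r \<ge> 1 / a"
        show "\<bar>w 0 r\<bar> \<le> \<bar>p\<bar> * K1 * N * exp (\<omega> * r)"
          using abs_mult_le[OF order_refl[of "\<bar>p\<bar>"] u[OF _ r, of 0]] bd(1)[of r] time[OF r, of 0]
          by (simp add: e_def mult_ac)
        show "\<bar>Dw 0 1 z r + a * Dw 1 0 z r\<bar> \<le> K1 * N * exp (\<omega> * r)" if "z \<in> {0..1}" for z
          using u[OF that r] eq(1)[OF that, of r] time[OF r, of 0] by (simp add: e_def mult_ac)
      qed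
      then show ?thesis
        by (simp add: K2_def e_def algebra_simps)
    qed

    have cb: "\<bar>c y s\<bar> \<le> C" "\<bar>Dc 0 1 y s\<bar> \<le> C" "\<bar>Dc 0 1 y s + a * Dc 1 0 y s\<bar> \<le> C + a * C"
      "\<bar>Dc 0 2 y s + a * Dc 1 1 y s\<bar> \<le> C + a * C" if "y \<in> {0..1}" "s \<ge> 0" for y s
    proof -
      show "\<bar>c y s\<bar> \<le> C" "\<bar>Dc 0 1 y s\<bar> \<le> C"
        using c_bound that Dc_bound[of 0 1] by auto
      have "\<bar>a * Dc 1 0 y s\<bar> \<le> a * C" "\<bar>a * Dc 1 1 y s\<bar> \<le> a * C"
        using a that by (auto simp: abs_mult intro!: mult_left_mono Dc_bound)
      moreover have "\<bar>Dc 0 1 y s\<bar> \<le> C" "\<bar>Dc 0 2 y s\<bar> \<le> C"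
        using that by (auto intro!: Dc_bound)
      ultimately show "\<bar>Dc 0 1 y s + a * Dc 1 0 y s\<bar> \<le> C + a * C"
        "\<bar>Dc 0 2 y s + a * Dc 1 1 y s\<bar> \<le> C + a * C"
        by linarith+
    qed
    note q = C1_strip_add[OF ut' C1_strip_cmult[OF C1_strip_mult[OF c' w'], of "1 / 2"]]
    let ?q = "\<lambda>y s. Du 0 1 y s + 1 / 2 * (c y s * w y s)"
    let ?qx = "\<lambda>y s. Du 1 1 y s + 1 / 2 * (Dc 1 0 y s * w y s + c y s * Dw 1 0 y s)"
    let ?qt = "\<lambda>y s. Du 0 2 y s + 1 / 2 * (Dc 0 1 y s * w y s + c y s * Dw 0 1 y s)"
    \<comment> \<open>The source of \<open>q\<close> contains no derivatives of the solution, since \<open>w\<^sub>t + a w\<^sub>x = u\<close>.\<close>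
    have r: "?qt y s + (- a) * ?qx y s
        = - (1 / 2) * ((Dc 0 1 y s + a * Dc 1 0 y s) * w y s + c y s * u y s)"
      if "y \<in> {0..1}" "s \<ge> 0" for y s
    proof -
      have "Du 0 2 y s = a * Du 1 1 y s - (Dc 0 1 y s * w y s + c y s * Dw 0 1 y s)"
        using deq(2)[OF that] by linarith
      then show ?thesis
        unfolding eq(1)[OF that, symmetric] by (simp add: field_simps)
    qed

    have q3: "\<bar>?q y s\<bar> \<le> Q3 * e s" if y: "y \<in> {0..1}" and s: "s \<ge> 3 / a" for y s
    proof -
      have "\<bar>?q y s\<bar> \<le> (C * K2 * N / 2 + (1 / 2 * ((C + a * C) * K2 + C * K1)) * N / a) * exp (\<omega> * s)"
      proof (rule transport_bound[OF a _ q _ \<omega>_nonneg _ _ y])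
        show "- a = a \<and> (1::real) = 0 \<or> - a = - a \<and> (1::real) = 1" "0 \<le> 2 / a" "2 / a + 1 / a \<le> s"
          using a s by (auto simp: field_simps)
        fix \<tau> assume \<tau>: "\<tau> \<ge> 2 / a"
        have \<tau>0: "\<tau> \<ge> 0" "1 / a \<le> \<tau>"
          using time[OF \<tau>, of 1] by auto
        show "\<bar>?q 1 \<tau>\<bar> \<le> C * K2 * N / 2 * exp (\<omega> * \<tau>)"
          using abs_mult_le[OF cb(1)[OF _ \<tau>0(1)] w[OF _ \<tau>], of 1] deq(6)[OF _ \<tau>0(1), of 1]
          by (simp add: e_def mult_ac)
        show "\<bar>?qt z \<tau> + (- a) * ?qx z \<tau>\<bar> \<le> (1 / 2 * ((C + a * C) * K2 + C * K1)) * N * exp (\<omega> * \<tau>)"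
          if z: "z \<in> {0..1}" for z
        proof -
          have "\<bar>(Dc 0 1 z \<tau> + a * Dc 1 0 z \<tau>) * w z \<tau>\<bar> \<le> (C + a * C) * (K2 * e \<tau>)"
            "\<bar>c z \<tau> * u z \<tau>\<bar> \<le> C * (K1 * e \<tau>)"
            by (intro abs_mult_le cb w u z \<tau>0 \<tau>)+
          then show ?thesis
            unfolding r[OF z \<tau>0(1)] e_def by (simp add: algebra_simps abs_le_iff)
        qed
      qed
      then show ?thesis
        using a by (simp add: Q3_def e_def algebra_simps add_divide_distrib)
    qed

    have ut: "\<bar>Du 0 1 y s\<bar> \<le> K3 * e s" if y: "y \<in> {0..1}" and s: "s \<ge> 3 / a" for y s
    proof -
      have s0: "s \<ge> 0" "2 / a \<le> s"
        using time[OF s, of 2] by auto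
      have "\<bar>c y s * w y s\<bar> \<le> C * (K2 * e s)"
        by (intro abs_mult_le cb w y s0)
      then show ?thesis
        using q3[OF y s] by (simp add: K3_def algebra_simps)
    qed

    have wt: "\<bar>Dw 0 1 y s\<bar> \<le> K4 * e s" if y: "y \<in> {0..1}" and s: "s \<ge> 4 / a" for y s
    proof -
      have "\<bar>Dw 0 1 y s\<bar> \<le> (\<bar>p\<bar> * K3 * N + K3 * N / a) * exp (\<omega> * s)"
      proof (rule transport_bound[OF a _ wt' _ \<omega>_nonneg _ _ y])
        show "a = a \<and> (0::real) = 0 \<or> a = - a \<and> (0::real) = 1" "0 \<le> 3 / a" "3 / a + 1 / a \<le> s"
          using a s by (auto simp: field_simps)
        fix r assume r: "r \<ge> 3 / a"
        show "\<bar>Dw 0 1 0 r\<bar> \<le> \<bar>p\<bar> * K3 * N * exp (\<omega> * r)"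
          using abs_mult_le[OF order_refl[of "\<bar>p\<bar>"] ut[OF _ r, of 0]] deq(4)[of 0 r] time[OF r, of 0]
          by (simp add: e_def mult_ac)
        show "\<bar>Dw 0 2 z r + a * Dw 1 1 z r\<bar> \<le> K3 * N * exp (\<omega> * r)" if "z \<in> {0..1}" for z
          using ut[OF that r] deq(1)[OF that, of r] time[OF r, of 0] by (simp add: e_def mult_ac)
      qed
      then show ?thesis
        by (simp add: K4_def e_def algebra_simps)
    qed

    have g: "\<bar>Dc 0 1 y s * w y s + c y s * Dw 0 1 y s\<bar> \<le> (C * K2 + C * K4) * e s"
      if y: "y \<in> {0..1}" and s: "s \<ge> 4 / a" for y s
    proof -
      have s0: "s \<ge> 0" "2 / a \<le> s"
        using time[OF s, of 2] by auto
      have "\<bar>Dc 0 1 y s * w y s\<bar> \<le> C * (K2 * e s)" "\<bar>c y s * Dw 0 1 y s\<bar> \<le> C * (K4 * e s)"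
        by (intro abs_mult_le cb w wt y s s0)+
      then show ?thesis
        by (simp add: algebra_simps)
    qed

    have q5: "\<bar>?qt y s\<bar> \<le> Q5 * e s" if y: "y \<in> {0..1}" and s: "s \<ge> 5 / a" for y s
    proof -
      define B where "B = (C * K2 + C * K4) * N / 2"
      define R where "R = (1 / 2 * ((C + a * C) * K2 + (C + a * C) * K4 + (C * K1 + C * K3))) * N"
      let ?rt = "\<lambda>y s. - (1 / 2) * (((Dc 0 2 y s + a * Dc 1 1 y s) * w y s
        + (Dc 0 1 y s + a * Dc 1 0 y s) * Dw 0 1 y s) + (Dc 0 1 y s * u y s + c y s * Du 0 1 y s))"
      have "\<bar>?qt y s\<bar> \<le> (B + R / a) * exp (\<omega> * s)"
      proof (rule transport_time_derivative_bound[OF a _ q _ \<omega>_nonneg _ _ _ y])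
        show "- a = a \<and> (1::real) = 0 \<or> - a = - a \<and> (1::real) = 1" "0 \<le> 4 / a" "4 / a + 1 / a \<le> s"
          using a s by (auto simp: field_simps)
        show "((\<lambda>s. ?qt z s + (- a) * ?qx z s) has_real_derivative ?rt z \<tau>) (at \<tau> within {0..})"
          if z: "z \<in> {0..1}" and \<tau>: "\<tau> \<ge> 0" for z \<tau>
        proof (rule has_field_derivative_transform_within[OF _ zero_less_one])
          have z': "0 \<le> z" "z \<le> 1"
            using z by auto
          have "((\<lambda>s. - (1 / 2) * ((Dc 0 1 z s + a * Dc 1 0 z s) * w z s + c z s * u z s)) has_real_derivative
              - (1 / 2) * (((Dc 0 2 z \<tau> + a * Dc 1 1 z \<tau>) * w z \<tau>
                + Dw 0 1 z \<tau> * (Dc 0 1 z \<tau> + a * Dc 1 0 z \<tau>)) + (Dc 0 1 z \<tau> * u z \<tau> + Du 0 1 z \<tau> * c z \<tau>)))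
              (at \<tau> within {0..})"
            by (intro DERIV_cmult DERIV_add DERIV_mult C1_stripD(2)[OF ct'] C1_stripD(2)[OF cx']
                C1_stripD(2)[OF w'] C1_stripD(2)[OF c'] C1_stripD(2)[OF u'] z' \<tau>)
          then show "((\<lambda>s. - (1 / 2) * ((Dc 0 1 z s + a * Dc 1 0 z s) * w z s + c z s * u z s)) has_real_derivative
              ?rt z \<tau>) (at \<tau> within {0..})"
            by (simp only: mult.commute[of "Dw 0 1 z \<tau>"] mult.commute[of "Du 0 1 z \<tau>"])
        qed (use \<tau> r[OF z] in auto)
        fix \<tau> assume \<tau>: "\<tau> \<ge> 4 / a"
        have \<tau>0: "\<tau> \<ge> 0" "1 / a \<le> \<tau>" "2 / a \<le> \<tau>" "3 / a \<le> \<tau>"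
          using time[OF \<tau>, of 1] time[OF \<tau>, of 2] time[OF \<tau>, of 3] by auto
        show "\<bar>?qt 1 \<tau>\<bar> \<le> B * exp (\<omega> * \<tau>)"
          using g[OF _ \<tau>, of 1] deq(7)[OF _ \<tau>0(1), of 1] by (simp add: B_def e_def mult_ac)
        show "\<bar>?rt z \<tau>\<bar> \<le> R * exp (\<omega> * \<tau>)" if z: "z \<in> {0..1}" for z
        proof -
          have "\<bar>(Dc 0 2 z \<tau> + a * Dc 1 1 z \<tau>) * w z \<tau>\<bar> \<le> (C + a * C) * (K2 * e \<tau>)"
            "\<bar>(Dc 0 1 z \<tau> + a * Dc 1 0 z \<tau>) * Dw 0 1 z \<tau>\<bar> \<le> (C + a * C) * (K4 * e \<tau>)"
            "\<bar>Dc 0 1 z \<tau> * u z \<tau>\<bar> \<le> C * (K1 * e \<tau>)" "\<bar>c z \<tau> * Du 0 1 z \<tau>\<bar> \<le> C * (K3 * e \<tau>)"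
            by (intro abs_mult_le cb w u wt ut z \<tau>0 \<tau>)+
          then have "\<bar>((Dc 0 2 z \<tau> + a * Dc 1 1 z \<tau>) * w z \<tau>
              + (Dc 0 1 z \<tau> + a * Dc 1 0 z \<tau>) * Dw 0 1 z \<tau>) + (Dc 0 1 z \<tau> * u z \<tau> + c z \<tau> * Du 0 1 z \<tau>)\<bar>
              \<le> (C + a * C) * (K2 * e \<tau>) + (C + a * C) * (K4 * e \<tau>) + (C * (K1 * e \<tau>) + C * (K3 * e \<tau>))"
            by linarith
          then show ?thesis
            unfolding abs_mult R_def e_def by (simp add: algebra_simps)
        qed
      qed
      then show ?thesis
        using a by (simp add: Q5_def B_def R_def e_def algebra_simps add_divide_distrib)
    qed

    have utt: "\<bar>Du 0 2 y s\<bar> \<le> K5 * e s" if y: "y \<in> {0..1}" and s: "s \<ge> 5 / a" for y s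
    proof -
      have "\<bar>Dc 0 1 y s * w y s + c y s * Dw 0 1 y s\<bar> \<le> (C * K2 + C * K4) * e s"
        using g[OF y, of s] time[OF s, of 4] by simp
      moreover have "\<bar>z\<bar> \<le> A + B / 2" if "\<bar>z + 1 / 2 * h\<bar> \<le> A" "\<bar>h\<bar> \<le> B" for z h A B :: real
        using that by linarith
      ultimately have "\<bar>Du 0 2 y s\<bar> \<le> Q5 * e s + (C * K2 + C * K4) * e s / 2"
        using q5[OF y s] by blast
      then show ?thesis
        by (simp add: K5_def algebra_simps)
    qed

    have wtt: "\<bar>Dw 0 2 y s\<bar> \<le> K6 * e s" if y: "y \<in> {0..1}" and s: "s \<ge> 6 / a" for y s
    proof -
      have "\<bar>Dw 0 2 y s\<bar> \<le> (\<bar>p\<bar> * K5 * N + K5 * N / a) * exp (\<omega> * s)"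
      proof (rule transport_time_derivative_bound[OF a _ wt' _ \<omega>_nonneg _ _ _ y])
        show "a = a \<and> (0::real) = 0 \<or> a = - a \<and> (0::real) = 1" "0 \<le> 5 / a" "5 / a + 1 / a \<le> s"
          using a s by (auto simp: field_simps)
        show "((\<lambda>s. Dw 0 2 z s + a * Dw 1 1 z s) has_real_derivative Du 0 2 z \<tau>) (at \<tau> within {0..})"
          if z: "z \<in> {0..1}" and \<tau>: "\<tau> \<ge> 0" for z \<tau>
          by (rule has_field_derivative_transform_within[OF C1_stripD(2)[OF ut', of z \<tau>] zero_less_one])
            (use z \<tau> deq(1) in auto)
        fix r assume r: "r \<ge> 5 / a"
        show "\<bar>Dw 0 2 0 r\<bar> \<le> \<bar>p\<bar> * K5 * N * exp (\<omega> * r)"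
          using abs_mult_le[OF order_refl[of "\<bar>p\<bar>"] utt[OF _ r, of 0]] deq(5)[of 0 r] time[OF r, of 0]
          by (simp add: e_def mult_ac)
        show "\<bar>Du 0 2 z r\<bar> \<le> K5 * N * exp (\<omega> * r)" if "z \<in> {0..1}" for z
          using utt[OF that r] by (simp add: e_def mult_ac)
      qed
      then show ?thesis
        by (simp add: K6_def e_def algebra_simps)
    qed

    have t': "0 \<le> t" "1 / a \<le> t" "2 / a \<le> t" "3 / a \<le> t" "4 / a \<le> t"
      using time[OF t, of 1] time[OF t, of 2] time[OF t, of 3] time[OF t, of 4] by auto
    have div: "\<bar>y / a\<bar> \<le> k / a * e t" if "\<bar>y\<bar> \<le> k * e t" for y k
      using divide_right_mono[OF that, of a] a by simp
    have b00: "\<bar>Dw 0 0 x t\<bar> \<le> K2 * e t"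
      using w[OF x t'(3)] C2_partials_C1_strip(4)[OF D(1) x t'(1)] by simp
    have b10: "\<bar>Dw 1 0 x t\<bar> \<le> X10 * e t"
    proof -
      have "Dw 1 0 x t = (u x t - Dw 0 1 x t) / a"
        using eq(1)[OF x t'(1)] a by (simp add: field_simps)
      moreover have "\<bar>u x t - Dw 0 1 x t\<bar> \<le> (K1 + K4) * e t"
        using u[OF x t'(2)] wt[OF x t'(5)] by (simp add: algebra_simps)
      ultimately show ?thesis
        unfolding X10_def using div by metis
    qed
    have b11: "\<bar>Dw 1 1 x t\<bar> \<le> X11 * e t"
    proof -
      have "Dw 1 1 x t = (Du 0 1 x t - Dw 0 2 x t) / a"
        using deq(1)[OF x t'(1)] a by (simp add: field_simps)
      moreover have "\<bar>Du 0 1 x t - Dw 0 2 x t\<bar> \<le> (K3 + K6) * e t"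
        using ut[OF x t'(4)] wtt[OF x t] by (simp add: algebra_simps)
      ultimately show ?thesis
        unfolding X11_def using div by metis
    qed
    have b20: "\<bar>Dw 2 0 x t\<bar> \<le> X20 * e t"
    proof -
      have "\<bar>c x t * w x t\<bar> \<le> C * (K2 * e t)"
        by (intro abs_mult_le cb w x t')
      then have "\<bar>Du 0 1 x t + c x t * w x t\<bar> \<le> (K3 + C * K2) * e t"
        using ut[OF x t'(4)] by (simp add: algebra_simps)
      moreover have "Du 1 0 x t = (Du 0 1 x t + c x t * w x t) / a"
        using eq(2)[OF x t'(1)] a by (simp add: field_simps)
      ultimately have "\<bar>Du 1 0 x t\<bar> \<le> (K3 + C * K2) / a * e t"
        using div by metis
      then have "\<bar>Du 1 0 x t - Dw 1 1 x t\<bar> \<le> ((K3 + C * K2) / a + X11) * e t"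
        using b11 by (simp add: algebra_simps)
      moreover have "Dw 2 0 x t = (Du 1 0 x t - Dw 1 1 x t) / a"
        using deq(3)[OF x t'(1)] a by (simp add: field_simps)
      ultimately show ?thesis
        unfolding X20_def using div by metis
    qed
    have weaken: "y \<le> K * e t" if "y \<le> k * e t" "k \<le> K" for y k
      using mult_right_mono[OF that(2) e0[of t]] that(1) by linarith
    have "(\<alpha>, \<beta>) \<in> {(0, 0), (0, 1), (0, 2), (1, 0), (1, 1), (2, 0)}"
      using \<alpha>\<beta> by auto
    then have "\<bar>Dw \<alpha> \<beta> x t\<bar> \<le> K * e t"
      using weaken[OF b00] weaken[OF wt[OF x t'(5)]] weaken[OF wtt[OF x t]]
        weaken[OF b10] weaken[OF b11] weaken[OF b20] nonneg
      by (auto simp: K_def)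
    then show ?thesis
      by (simp add: e_def mult_ac)
  qed
  have "K \<ge> 0"
    using nonneg by (simp add: K_def)
  then show thesis
    using main by (rule that)
qed

end

section \<open>The space L2\<close>

lemma L2_norm_nonneg: "L2_norm f \<ge> 0"
  by (simp add: L2_norm_def)

lemma L2_norm_power2: "(L2_norm f)\<^sup>2 = (LINT x|unit_lebesgue. (f x)\<^sup>2)"
  by (simp add: L2_norm_def)

lemma L2_norm_cong:
  assumes "\<And>x. x \<in> {0<..<1} \<Longrightarrow> f x = g x"
  shows "L2_norm f = L2_norm g"
  unfolding L2_norm_def using assms by (intro arg_cong[of _ _ sqrt] Bochner_Integration.integral_cong) auto

lemma square_sum_le: "((x::real) + y)\<^sup>2 \<le> 2 * x\<^sup>2 + 2 * y\<^sup>2"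
  using sum_squares_bound[of x y] by (simp add: power2_sum)

lemma L2_add:
  assumes f: "f \<in> L2" and g: "g \<in> L2"
  shows "(\<lambda>x. f x + g x) \<in> L2"
    and "(L2_norm (\<lambda>x. f x + g x))\<^sup>2 \<le> 2 * (L2_norm f)\<^sup>2 + 2 * (L2_norm g)\<^sup>2"
proof -
  have [measurable]: "f \<in> borel_measurable unit_lebesgue" "g \<in> borel_measurable unit_lebesgue"
    using assms by (auto simp: L2_def)
  have i: "integrable unit_lebesgue (\<lambda>x. 2 * (f x)\<^sup>2 + 2 * (g x)\<^sup>2)"
    using assms by (auto simp: L2_def)
  have fg: "integrable unit_lebesgue (\<lambda>x. (f x + g x)\<^sup>2)"
    by (rule Bochner_Integration.integrable_bound[OF i]) (auto simp: square_sum_le)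
  then show "(\<lambda>x. f x + g x) \<in> L2"
    by (simp add: L2_def)
  have "(LINT x|unit_lebesgue. (f x + g x)\<^sup>2) \<le> (LINT x|unit_lebesgue. 2 * (f x)\<^sup>2 + 2 * (g x)\<^sup>2)"
    by (rule integral_mono[OF fg i]) (rule square_sum_le)
  also have "\<dots> = 2 * (L2_norm f)\<^sup>2 + 2 * (L2_norm g)\<^sup>2"
    using assms by (simp add: L2_norm_power2 L2_def)
  finally show "(L2_norm (\<lambda>x. f x + g x))\<^sup>2 \<le> 2 * (L2_norm f)\<^sup>2 + 2 * (L2_norm g)\<^sup>2"
    by (simp add: L2_norm_power2)
qed

lemma L2_cmult:
  assumes "f \<in> L2"
  shows "(\<lambda>x. k * f x) \<in> L2" "(L2_norm (\<lambda>x. k * f x))\<^sup>2 = k\<^sup>2 * (L2_norm f)\<^sup>2"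
  using assms by (auto simp: L2_norm_power2 L2_def power_mult_distrib)

lemma L2_diff:
  assumes f: "f \<in> L2" and g: "g \<in> L2"
  shows "(\<lambda>x. f x - g x) \<in> L2"
    and "(L2_norm (\<lambda>x. f x - g x))\<^sup>2 \<le> 2 * (L2_norm f)\<^sup>2 + 2 * (L2_norm g)\<^sup>2"
  using L2_add[OF f L2_cmult(1)[OF g, of "- 1"]] L2_cmult(2)[OF g, of "- 1"] by simp_all

lemma L2_continuous:
  assumes "continuous_on {0..1} f"
  shows "f \<in> L2" "(L2_norm f)\<^sup>2 = integral {0..1} (\<lambda>x. (f x)\<^sup>2)"
proof -
  have sq: "continuous_on {0..1} (\<lambda>x. (f x)\<^sup>2)"
    using assms by (intro continuous_intros)
  have "integrable (lebesgue_on {0..1}) (\<lambda>x. (f x)\<^sup>2)"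
    using sq by (rule continuous_imp_integrable_real)
  then have "set_integrable lebesgue {0..1} (\<lambda>x. (f x)\<^sup>2)"
    by (simp add: integrable_restrict_space set_integrable_def)
  then have "set_integrable lebesgue {0<..<1} (\<lambda>x. (f x)\<^sup>2)"
    by (rule set_integrable_subset) auto
  then have int: "integrable unit_lebesgue (\<lambda>x. (f x)\<^sup>2)"
    by (simp add: integrable_restrict_space set_integrable_def)
  have "continuous_on {0<..<1} f"
    using assms by (rule continuous_on_subset) auto
  then have "f \<in> borel_measurable unit_lebesgue"
    by (rule continuous_imp_measurable_on_sets_lebesgue) auto
  with int show "f \<in> L2"
    by (simp add: L2_def)
  show "(L2_norm f)\<^sup>2 = integral {0..1} (\<lambda>x. (f x)\<^sup>2)"
    unfolding L2_norm_power2 integral_open_interval_real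
    by (rule lebesgue_integral_eq_integral[OF int]) auto
qed

lemma L2_cong:
  assumes "f \<in> L2" "\<And>x. x \<in> {0<..<1} \<Longrightarrow> f x = g x"
  shows "g \<in> L2"
proof -
  have "f \<in> borel_measurable unit_lebesgue \<longleftrightarrow> g \<in> borel_measurable unit_lebesgue"
    by (rule measurable_cong) (use assms in auto)
  moreover have "integrable unit_lebesgue (\<lambda>x. (f x)\<^sup>2) \<longleftrightarrow> integrable unit_lebesgue (\<lambda>x. (g x)\<^sup>2)"
    by (rule Bochner_Integration.integrable_cong) (use assms in auto)
  ultimately show ?thesis
    using assms(1) by (simp add: L2_def)
qed

text \<open>
  On a bounded interval uniform convergence implies convergence in L2, where limits are unique up to
  null sets. This identifies the generalized solution with the smooth limit.
\<close>

lemma AE_eq_of_L2_limit: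
  assumes w: "w \<in> L2" and v: "continuous_on {0..1} v" and W: "\<And>l. continuous_on {0..1} (W l)"
    and lim: "(\<lambda>l::nat. L2_norm (\<lambda>x. w x - W l x)) \<longlonglongrightarrow> 0"
    and unif: "uniform_limit {0..1} W v sequentially"
  shows "AE x in unit_lebesgue. w x = v x"
proof -
  have "(L2_norm (\<lambda>x. w x - v x))\<^sup>2 \<le> 0 + \<epsilon>" if "\<epsilon> > 0" for \<epsilon>
  proof -
    define d where "d = sqrt (\<epsilon> / 4)"
    have d: "d > 0" "d\<^sup>2 = \<epsilon> / 4"
      using that by (simp_all add: d_def)
    have "\<forall>\<^sub>F l in sequentially. L2_norm (\<lambda>x. w x - W l x) < d"
      using order_tendstoD(2)[OF lim d(1)] .
    moreover have "\<forall>\<^sub>F l in sequentially. \<forall>x\<in>{0..1}. dist (W l x) (v x) < d"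
      using unif d(1) by (simp add: uniform_limit_iff)
    ultimately have "\<forall>\<^sub>F l in sequentially. L2_norm (\<lambda>x. w x - W l x) < d \<and> (\<forall>x\<in>{0..1}. dist (W l x) (v x) < d)"
      by (rule eventually_conj)
    then obtain l where l: "L2_norm (\<lambda>x. w x - W l x) < d" "\<And>x. x \<in> {0..1} \<Longrightarrow> dist (W l x) (v x) < d"
      using eventually_happens'[OF sequentially_bot] by blast
    have "(L2_norm (\<lambda>x. w x - W l x))\<^sup>2 \<le> d\<^sup>2"
      using l(1) L2_norm_nonneg by (intro power_mono) auto
    moreover have "(L2_norm (\<lambda>x. W l x - v x))\<^sup>2 \<le> d\<^sup>2"
    proof -
      have c: "continuous_on {0..1} (\<lambda>x. W l x - v x)"
        by (intro continuous_intros W v)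
      have "integral {0..1} (\<lambda>x. (W l x - v x)\<^sup>2) \<le> integral {0..1} (\<lambda>x::real. d\<^sup>2)"
      proof (rule integral_le)
        show "(W l x - v x)\<^sup>2 \<le> d\<^sup>2" if "x \<in> {0..1}" for x
          using power_mono[of "\<bar>W l x - v x\<bar>" d 2] l(2)[OF that] by (simp add: dist_real_def)
      qed (intro integrable_continuous_interval continuous_intros c)+
      then show ?thesis
        by (simp add: L2_continuous(2)[OF c])
    qed
    moreover have "(L2_norm (\<lambda>x. w x - v x))\<^sup>2
        \<le> 2 * (L2_norm (\<lambda>x. w x - W l x))\<^sup>2 + 2 * (L2_norm (\<lambda>x. W l x - v x))\<^sup>2"
      using L2_add(2)[OF L2_diff(1)[OF w L2_continuous(1)[OF W]] L2_diff(1)[OF L2_continuous(1)[OF W] L2_continuous(1)[OF v]],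
          of l l] by simp
    ultimately show ?thesis
      using d(2) by linarith
  qed
  then have "(L2_norm (\<lambda>x. w x - v x))\<^sup>2 \<le> 0"
    by (rule field_le_epsilon)
  then have "(LINT x|unit_lebesgue. (w x - v x)\<^sup>2) = 0"
    unfolding L2_norm_power2[symmetric] by (metis order_antisym zero_le_power2)
  moreover have "integrable unit_lebesgue (\<lambda>x. (w x - v x)\<^sup>2)"
    using L2_diff(1)[OF w L2_continuous(1)[OF v]] by (simp add: L2_def)
  ultimately have "AE x in unit_lebesgue. (w x - v x)\<^sup>2 = 0"
    by (subst (asm) integral_nonneg_eq_0_iff_AE) auto
  then show ?thesis
    by (rule AE_mp) auto
qed

section \<open>Passage to the limit\<close>

lemma has_real_derivative_uniform_limit:
  fixes f :: "nat \<Rightarrow> real \<Rightarrow> real"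
  assumes "convex S" and f: "\<And>l s. s \<in> S \<Longrightarrow> (f l has_real_derivative f' l s) (at s within S)"
    and unif: "uniform_limit S f' g' sequentially"
    and lim: "\<And>s. s \<in> S \<Longrightarrow> (\<lambda>l. f l s) \<longlonglongrightarrow> g s" and s: "s \<in> S"
  shows "(g has_real_derivative g' s) (at s within S)"
proof -
  have "\<exists>h. \<forall>x\<in>S. (\<lambda>l. f l x) \<longlonglongrightarrow> h x \<and> (h has_derivative (\<lambda>y. g' x * y)) (at x within S)"
  proof (rule has_derivative_sequence[OF \<open>convex S\<close> _ _ s])
    show "(f l has_derivative (\<lambda>y. f' l x * y)) (at x within S)" if "x \<in> S" for l x
      using f[OF that] by (simp add: has_field_derivative_def)
    show "\<forall>\<^sub>F l in sequentially. \<forall>x\<in>S. \<forall>y. norm (f' l x * y - g' x * y) \<le> e * norm y" if "e > 0" for e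
      using uniform_limitD[OF unif that]
    proof eventually_elim
      case (elim l)
      then have "\<bar>f' l x - g' x\<bar> * \<bar>y\<bar> \<le> e * \<bar>y\<bar>" if "x \<in> S" for x y
        using that by (intro mult_right_mono) (auto simp: dist_real_def)
      then show ?case
        by (simp add: abs_mult flip: left_diff_distrib)
    qed
    show "(\<lambda>l. f l s) \<longlonglongrightarrow> g s"
      by (rule lim[OF s])
  qed
  then obtain h where h: "\<And>x. x \<in> S \<Longrightarrow> (\<lambda>l. f l x) \<longlonglongrightarrow> h x"
    "\<And>x. x \<in> S \<Longrightarrow> (h has_real_derivative g' x) (at x within S)"
    by (auto simp: has_field_derivative_def)
  have "h x = g x" if "x \<in> S" for x
    using h(1)[OF that] lim[OF that] by (rule LIMSEQ_unique)
  then show ?thesis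
    using has_field_derivative_transform_within[OF h(2)[OF s] zero_less_one s] by blast
qed

lemma iterated_partials_uniform_limit:
  assumes T: "T \<ge> 0" and W: "\<And>l. iterated_partials 0 (W l) (DW l)"
    and lim: "\<And>\<alpha> \<beta> T'. \<alpha> + \<beta> \<le> 2 \<Longrightarrow>
      uniform_limit ({0..1} \<times> {T..T'}) (\<lambda>l (x, t). DW l \<alpha> \<beta> x t) (\<lambda>(x, t). D \<alpha> \<beta> x t) sequentially"
  shows "iterated_partials T (D 0 0) D"
proof -
  have pt: "(\<lambda>l. DW l \<alpha> \<beta> x t) \<longlonglongrightarrow> D \<alpha> \<beta> x t" if "\<alpha> + \<beta> \<le> 2" "x \<in> {0..1}" "t \<ge> T" for \<alpha> \<beta> x t
    using tendsto_uniform_limitI[OF lim[OF that(1), of t], of "(x, t)"] that by auto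
  have t: "((\<lambda>s. D 0 \<beta> x s) has_real_derivative D 0 (Suc \<beta>) x t) (at t within {T..})"
    if x: "x \<in> {0..1}" and t: "t \<ge> T" and \<beta>: "\<beta> < 2" for x t \<beta>
  proof -
    have "((\<lambda>s. D 0 \<beta> x s) has_real_derivative D 0 (Suc \<beta>) x t) (at t within {T..t + 1})"
    proof (rule has_real_derivative_uniform_limit[where f = "\<lambda>l s. DW l 0 \<beta> x s" and f' = "\<lambda>l s. DW l 0 (Suc \<beta>) x s"])
      show "((\<lambda>s. DW l 0 \<beta> x s) has_real_derivative DW l 0 (Suc \<beta>) x s) (at s within {T..t + 1})"
        if "s \<in> {T..t + 1}" for l s
      proof (rule DERIV_subset)
        show "((\<lambda>s. DW l 0 \<beta> x s) has_real_derivative DW l 0 (Suc \<beta>) x s) (at s within {0..})"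
          using W[of l] x \<beta> T that by (simp add: iterated_partials_def)
      qed (use T in auto)
      have "uniform_limit {T..t + 1} (\<lambda>l s. case (x, s) of (x, t) \<Rightarrow> DW l 0 (Suc \<beta>) x t)
          (\<lambda>s. case (x, s) of (x, t) \<Rightarrow> D 0 (Suc \<beta>) x t) sequentially"
        by (rule uniform_limit_compose'[OF lim[of 0 "Suc \<beta>" "t + 1"]]) (use x \<beta> in auto)
      then show "uniform_limit {T..t + 1} (\<lambda>l s. DW l 0 (Suc \<beta>) x s) (\<lambda>s. D 0 (Suc \<beta>) x s) sequentially"
        by simp
    qed (use x t \<beta> pt in auto)
    moreover have "at t within {T..} = at t within {T..t + 1}"
      by (rule at_within_nhd[of _ "{..<t + 1}"]) auto
    ultimately show ?thesis
      by simp
  qed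
  have x: "((\<lambda>y. D \<alpha> \<beta> y t) has_real_derivative D (Suc \<alpha>) \<beta> x t) (at x within {0..1})"
    if x: "x \<in> {0..1}" and t: "t \<ge> T" and \<alpha>\<beta>: "\<alpha> + \<beta> < 2" for x t \<alpha> \<beta>
  proof (rule has_real_derivative_uniform_limit[where f = "\<lambda>l y. DW l \<alpha> \<beta> y t" and f' = "\<lambda>l y. DW l (Suc \<alpha>) \<beta> y t"])
    show "((\<lambda>y. DW l \<alpha> \<beta> y t) has_real_derivative DW l (Suc \<alpha>) \<beta> y t) (at y within {0..1})"
      if "y \<in> {0..1}" for l y
      using W[of l] t \<alpha>\<beta> T that by (simp add: iterated_partials_def)
    have "uniform_limit {0..1} (\<lambda>l y. case (y, t) of (x, t) \<Rightarrow> DW l (Suc \<alpha>) \<beta> x t)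
        (\<lambda>y. case (y, t) of (x, t) \<Rightarrow> D (Suc \<alpha>) \<beta> x t) sequentially"
      by (rule uniform_limit_compose'[OF lim[of "Suc \<alpha>" \<beta> t]]) (use t \<alpha>\<beta> in auto)
    then show "uniform_limit {0..1} (\<lambda>l y. DW l (Suc \<alpha>) \<beta> y t) (\<lambda>y. D (Suc \<alpha>) \<beta> y t) sequentially"
      by simp
  qed (use x t \<alpha>\<beta> pt in auto)
  show ?thesis
    unfolding iterated_partials_def using t x by auto
qed

context dissipative_problem
begin

lemma energy_initial:
  assumes sol: "solution w u Dw Du" and \<phi>: "\<And>x. x \<in> {0..1} \<Longrightarrow> w x 0 = \<phi>1 x" "\<And>x. x \<in> {0..1} \<Longrightarrow> u x 0 = \<phi>2 x"
  shows "\<phi>1 \<in> L2" "\<phi>2 \<in> L2" "energy w u 0 = (L2_norm \<phi>1)\<^sup>2 + \<kappa> * (L2_norm \<phi>2)\<^sup>2"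
proof -
  have slice: "continuous_on {0..1} (\<lambda>x. g x 0)"
    if "continuous_on ({0..1} \<times> {0..}) (\<lambda>(x, t). g x t)" for g :: "real \<Rightarrow> real \<Rightarrow> real"
    by (rule continuous_on_strip_compose[OF that]) (auto intro: continuous_intros)
  have "C1_strip w (Dw 1 0) (Dw 0 1)" "C1_strip u (Du 1 0) (Du 0 1)"
    using sol C2_partials_C1_strip(1) by (auto simp: solution_def)
  note w = slice[OF C1_stripD(3)[OF this(1)]] and u = slice[OF C1_stripD(3)[OF this(2)]]
  show "\<phi>1 \<in> L2" "\<phi>2 \<in> L2"
    by (rule L2_cong[OF L2_continuous(1)[OF w]] L2_cong[OF L2_continuous(1)[OF u]]; use \<phi> in auto)+
  have n: "L2_norm (\<lambda>x. w x 0) = L2_norm \<phi>1" "L2_norm (\<lambda>x. u x 0) = L2_norm \<phi>2"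
    by (rule L2_norm_cong; use \<phi> in auto)+
  have "energy w u 0 = integral {0..1} (\<lambda>x. (w x 0)\<^sup>2) + integral {0..1} (\<lambda>x. \<kappa> * (u x 0)\<^sup>2)"
    unfolding energy_def
    by (rule integral_add) (intro integrable_continuous_interval continuous_intros w u)+
  then show "energy w u 0 = (L2_norm \<phi>1)\<^sup>2 + \<kappa> * (L2_norm \<phi>2)\<^sup>2"
    unfolding n[symmetric] L2_continuous(2)[OF w] L2_continuous(2)[OF u] by simp
qed

text \<open>
  In this form the energy of an approximating solution is bounded by the norms of the limit data up to an
  error that tends to zero.
\<close>

lemma energy_near:
  assumes sol: "solution w u Dw Du" and \<phi>: "\<And>x. x \<in> {0..1} \<Longrightarrow> w x 0 = \<phi>1 x" "\<And>x. x \<in> {0..1} \<Longrightarrow> u x 0 = \<phi>2 x"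
    and \<psi>: "\<psi>1 \<in> L2" "\<psi>2 \<in> L2"
  shows "energy w u 0 \<le> 2 * (L2_norm (\<lambda>x. \<phi>1 x - \<psi>1 x))\<^sup>2 + 2 * (L2_norm \<psi>1)\<^sup>2
    + \<kappa> * (2 * (L2_norm (\<lambda>x. \<phi>2 x - \<psi>2 x))\<^sup>2 + 2 * (L2_norm \<psi>2)\<^sup>2)"
proof -
  note E = energy_initial[OF sol \<phi>]
  have "(L2_norm \<phi>1)\<^sup>2 \<le> 2 * (L2_norm (\<lambda>x. \<phi>1 x - \<psi>1 x))\<^sup>2 + 2 * (L2_norm \<psi>1)\<^sup>2"
    using L2_add(2)[OF L2_diff(1)[OF E(1) \<psi>(1)] \<psi>(1)] by simp
  moreover have "(L2_norm \<phi>2)\<^sup>2 \<le> 2 * (L2_norm (\<lambda>x. \<phi>2 x - \<psi>2 x))\<^sup>2 + 2 * (L2_norm \<psi>2)\<^sup>2"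
    using L2_add(2)[OF L2_diff(1)[OF E(2) \<psi>(2)] \<psi>(2)] by simp
  then have "\<kappa> * (L2_norm \<phi>2)\<^sup>2 \<le> \<kappa> * (2 * (L2_norm (\<lambda>x. \<phi>2 x - \<psi>2 x))\<^sup>2 + 2 * (L2_norm \<psi>2)\<^sup>2)"
    using \<kappa>_ge_1 by (intro mult_left_mono) auto
  ultimately show ?thesis
    using E(3) by linarith
qed

text \<open>
  The initial data enter \<open>derivative_bounds\<close> only through the energy at time zero. Applied to differences,
  it therefore makes every approximating sequence a Cauchy sequence together with its derivatives up to
  order two; applied to the sequence itself, it gives the bounds.
  The constant \<open>Q\<close> of the proof comes from \<open>\<psi> = w1 + a w0'\<close>, the initial value of \<open>u\<close>, whose squared norm is at
  most \<open>2 (1 + a\<^sup>2)\<close> times the squared maximum of the norms of \<open>w0\<close> and \<open>w1\<close>.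
\<close>

lemma generalized_solution_regularity:
  obtains M where "\<And>w0 w1 w. \<lbrakk>w0 \<in> H1; w1 \<in> L2; L2_generalized_solution a p c w0 w1 w\<rbrakk> \<Longrightarrow>
    \<exists>D. (\<forall>t\<ge>6 / a. AE x in unit_lebesgue. w x t = D 0 0 x t) \<and> iterated_partials (6 / a) (D 0 0) D \<and>
      (\<forall>\<alpha> \<beta> t. \<alpha> + \<beta> \<le> 2 \<longrightarrow> t \<ge> 6 / a \<longrightarrow> continuous_on {0..1} (\<lambda>x. D \<alpha> \<beta> x t) \<and>
        (\<forall>x\<in>{0..1}. \<bar>D \<alpha> \<beta> x t\<bar> \<le> M * exp (\<omega> * t) * max (H1_norm w0) (L2_norm w1)))"
proof -
  obtain K where K: "K \<ge> 0" and bound: "\<And>w u Dw Du N \<alpha> \<beta> x t.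
      \<lbrakk>solution w u Dw Du; energy w u 0 \<le> N\<^sup>2; N > 0; \<alpha> + \<beta> \<le> 2; x \<in> {0..1}; t \<ge> 6 / a\<rbrakk>
      \<Longrightarrow> \<bar>Dw \<alpha> \<beta> x t\<bar> \<le> K * N * exp (\<omega> * t)"
    using derivative_bounds by blast
  define Q where "Q = sqrt (2 + 4 * \<kappa> * (1 + a\<^sup>2))"
  have Q: "Q \<ge> 0" "Q\<^sup>2 = 2 + 4 * \<kappa> * (1 + a\<^sup>2)"
    using \<kappa>_ge_1 by (simp_all add: Q_def)
  have T: "6 / a > 0"
    using a by simp
  show thesis
  proof (rule that[of "K * Q"])
    fix w0 w1 :: "real \<Rightarrow> real" and w
    assume w0: "w0 \<in> H1" and w1: "w1 \<in> L2" and gen: "L2_generalized_solution a p c w0 w1 w"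
    define \<psi> where "\<psi> = (\<lambda>x. w1 x + a * weak_deriv w0 x)"
    define m where "m = max (H1_norm w0) (L2_norm w1)"
    from gen obtain u \<phi>1 \<phi>2 W U where w: "continuous_into_L2 w"
      and \<phi>1: "(\<lambda>l::nat. L2_norm (\<lambda>x. \<phi>1 l x - w0 x)) \<longlonglongrightarrow> 0"
      and \<phi>2: "(\<lambda>l. L2_norm (\<lambda>x. \<phi>2 l x - \<psi> x)) \<longlonglongrightarrow> 0"
      and cl: "\<And>l. classical_solution a p c (\<phi>1 l) (\<phi>2 l) (W l) (U l)"
      and Wlim: "\<And>t. t > 0 \<Longrightarrow>
        uniform_limit {0..t} (\<lambda>l \<theta>. L2_norm (\<lambda>x. w x \<theta> - W l x \<theta>)) (\<lambda>\<theta>. 0) sequentially"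
      unfolding L2_generalized_solution_def \<psi>_def by blast
    have "\<exists>Dw Du. solution (W l) (U l) Dw Du" for l
      using classical_solution_imp_solution[OF cl[of l]] by metis
    then obtain DW DU where sol: "\<And>l. solution (W l) (U l) (DW l) (DU l)"
      by metis
    have init: "W l x 0 = \<phi>1 l x" "U l x 0 = \<phi>2 l x" if "x \<in> {0..1}" for l x
      using cl[of l] that by (auto simp: classical_solution_def)
    have wd: "weak_deriv w0 \<in> L2"
    proof -
      have "\<exists>g. g \<in> L2 \<and> has_weak_deriv w0 g"
        using w0 by (auto simp: H1_def)
      then show ?thesis
        unfolding weak_deriv_def by (rule someI2_ex) auto
    qed
    have w0': "w0 \<in> L2"
      using w0 by (simp add: H1_def)
    have \<psi>: "\<psi> \<in> L2"
      unfolding \<psi>_def by (rule L2_add(1)[OF w1 L2_cmult(1)[OF wd]])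

    have m: "m \<ge> 0" "(L2_norm w0)\<^sup>2 \<le> m\<^sup>2" "(L2_norm \<psi>)\<^sup>2 \<le> 2 * (1 + a\<^sup>2) * m\<^sup>2"
    proof -
      show m0: "m \<ge> 0"
        unfolding m_def using L2_norm_nonneg[of w1] by linarith
      have "0 \<le> H1_norm w0" "H1_norm w0 \<le> m"
        by (auto simp: H1_norm_def m_def)
      then have "(H1_norm w0)\<^sup>2 \<le> m\<^sup>2"
        by (intro power_mono)
      moreover have "(H1_norm w0)\<^sup>2 = (L2_norm w0)\<^sup>2 + (L2_norm (weak_deriv w0))\<^sup>2"
        by (simp add: H1_norm_def)
      ultimately have d: "(L2_norm w0)\<^sup>2 \<le> m\<^sup>2" "(L2_norm (weak_deriv w0))\<^sup>2 \<le> m\<^sup>2"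
        using zero_le_power2[of "L2_norm w0"] zero_le_power2[of "L2_norm (weak_deriv w0)"] by linarith+
      show "(L2_norm w0)\<^sup>2 \<le> m\<^sup>2"
        by (rule d(1))
      have "(L2_norm w1)\<^sup>2 \<le> m\<^sup>2"
        by (rule power_mono) (auto simp: m_def L2_norm_nonneg)
      moreover have "a\<^sup>2 * (L2_norm (weak_deriv w0))\<^sup>2 \<le> a\<^sup>2 * m\<^sup>2"
        by (intro mult_left_mono d(2)) auto
      ultimately show "(L2_norm \<psi>)\<^sup>2 \<le> 2 * (1 + a\<^sup>2) * m\<^sup>2"
        using L2_add(2)[OF w1 L2_cmult(1)[OF wd, of a]] L2_cmult(2)[OF wd, of a]
        unfolding \<psi>_def by (simp add: algebra_simps)
    qed

    define err where "err = (\<lambda>l. 2 * (L2_norm (\<lambda>x. \<phi>1 l x - w0 x))\<^sup>2 + \<kappa> * (2 * (L2_norm (\<lambda>x. \<phi>2 l x - \<psi> x))\<^sup>2))"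
    have "err \<longlonglongrightarrow> 2 * 0\<^sup>2 + \<kappa> * (2 * 0\<^sup>2)"
      unfolding err_def by (intro tendsto_intros \<phi>1 \<phi>2)
    then have err: "\<forall>\<^sub>F l in sequentially. err l < \<epsilon>" if "\<epsilon> > 0" for \<epsilon>
      using order_tendstoD(2)[of err 0 sequentially] that by simp
    have near: "energy (W l) (U l) 0 \<le> err l + Q\<^sup>2 * m\<^sup>2" for l
    proof -
      have "2 * (L2_norm w0)\<^sup>2 + \<kappa> * (2 * (L2_norm \<psi>)\<^sup>2) \<le> 2 * m\<^sup>2 + \<kappa> * (2 * (2 * (1 + a\<^sup>2) * m\<^sup>2))"
        using m \<kappa>_ge_1 by (intro add_mono mult_left_mono) auto
      also have "\<dots> = Q\<^sup>2 * m\<^sup>2"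
        by (simp add: Q(2) algebra_simps)
      finally show ?thesis
        using energy_near[OF sol[of l] init[of _ l] w0' \<psi>] by (simp add: err_def algebra_simps)
    qed
    have diff: "energy (\<lambda>x t. W l x t - W k x t) (\<lambda>x t. U l x t - U k x t) 0 \<le> err l + err k" for l k
    proof -
      note L = energy_initial(1,2)[OF sol[of l] init[of _ l]] and K = energy_initial(1,2)[OF sol[of k] init[of _ k]]
      have 1: "(L2_norm (\<lambda>x. \<phi>1 l x - \<phi>1 k x))\<^sup>2 \<le>
          2 * (L2_norm (\<lambda>x. \<phi>1 l x - w0 x))\<^sup>2 + 2 * (L2_norm (\<lambda>x. \<phi>1 k x - w0 x))\<^sup>2"
        using L2_diff(2)[OF L2_diff(1)[OF L(1) w0'] L2_diff(1)[OF K(1) w0']] by simp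
      have 2: "(L2_norm (\<lambda>x. \<phi>2 l x - \<phi>2 k x))\<^sup>2 \<le>
          2 * (L2_norm (\<lambda>x. \<phi>2 l x - \<psi> x))\<^sup>2 + 2 * (L2_norm (\<lambda>x. \<phi>2 k x - \<psi> x))\<^sup>2"
        using L2_diff(2)[OF L2_diff(1)[OF L(2) \<psi>] L2_diff(1)[OF K(2) \<psi>]] by simp
      have "energy (\<lambda>x t. W l x t - W k x t) (\<lambda>x t. U l x t - U k x t) 0 =
          (L2_norm (\<lambda>x. \<phi>1 l x - \<phi>1 k x))\<^sup>2 + \<kappa> * (L2_norm (\<lambda>x. \<phi>2 l x - \<phi>2 k x))\<^sup>2"
        by (rule energy_initial(3)[OF solution_diff[OF sol[of l] sol[of k]]]) (simp_all add: init)
      also have "\<dots> \<le> (2 * (L2_norm (\<lambda>x. \<phi>1 l x - w0 x))\<^sup>2 + 2 * (L2_norm (\<lambda>x. \<phi>1 k x - w0 x))\<^sup>2)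
          + \<kappa> * (2 * (L2_norm (\<lambda>x. \<phi>2 l x - \<psi> x))\<^sup>2 + 2 * (L2_norm (\<lambda>x. \<phi>2 k x - \<psi> x))\<^sup>2)"
        using 1 2 \<kappa>_ge_1 by (intro add_mono mult_left_mono) auto
      also have "\<dots> = err l + err k"
        by (simp add: err_def algebra_simps)
      finally show ?thesis .
    qed

    define D where "D = (\<lambda>\<alpha> \<beta> x t. lim (\<lambda>l. DW l \<alpha> \<beta> x t))"
    have unif: "uniform_limit ({0..1} \<times> {6 / a..T'}) (\<lambda>l (x, t). DW l \<alpha> \<beta> x t) (\<lambda>(x, t). D \<alpha> \<beta> x t) sequentially"
      if \<alpha>\<beta>: "\<alpha> + \<beta> \<le> 2" for \<alpha> \<beta> T'
    proof -
      have "uniformly_Cauchy_on ({0..1} \<times> {6 / a..T'}) (\<lambda>l (x, t). DW l \<alpha> \<beta> x t)"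
        unfolding uniformly_Cauchy_on_def
      proof (intro allI impI)
        fix e :: real assume "e > 0"
        \<comment> \<open>\<open>K + 1\<close> instead of \<open>K\<close>, because \<open>K\<close> may vanish.\<close>
        define N where "N = e / ((K + 1) * exp (\<omega> * T'))"
        have N: "N > 0"
          using K \<open>e > 0\<close> by (simp add: N_def)
        then obtain L where L: "\<And>l. l \<ge> L \<Longrightarrow> err l < N\<^sup>2 / 2"
          using err[of "N\<^sup>2 / 2"] unfolding eventually_sequentially by auto
        have "dist (DW l \<alpha> \<beta> x t) (DW k \<alpha> \<beta> x t) < e"
          if "x \<in> {0..1}" "t \<in> {6 / a..T'}" "l \<ge> L" "k \<ge> L" for x t l k
        proof -
          have "energy (\<lambda>x t. W l x t - W k x t) (\<lambda>x t. U l x t - U k x t) 0 \<le> N\<^sup>2"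
            using diff[of l k] L[OF that(3)] L[OF that(4)] by linarith
          then have "\<bar>DW l \<alpha> \<beta> x t - DW k \<alpha> \<beta> x t\<bar> \<le> K * N * exp (\<omega> * t)"
            using bound[OF solution_diff[OF sol[of l] sol[of k]] _ N \<alpha>\<beta>] that by auto
          also have "\<dots> \<le> K * N * exp (\<omega> * T')"
            using that K N \<omega>_nonneg by (intro mult_left_mono) (auto intro: mult_left_mono)
          also have "\<dots> < (K + 1) * N * exp (\<omega> * T')"
            using N by simp
          also have "\<dots> = e"
            using K by (simp add: N_def)
          finally show ?thesis
            by (simp add: dist_real_def)
        qed
        then show "\<exists>M. \<forall>z\<in>{0..1} \<times> {6 / a..T'}. \<forall>l\<ge>M. \<forall>k\<ge>M.
            dist (case z of (x, t) \<Rightarrow> DW l \<alpha> \<beta> x t) (case z of (x, t) \<Rightarrow> DW k \<alpha> \<beta> x t) < e"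
          by (intro exI[of _ L]) auto
      qed
      then have "uniformly_convergent_on ({0..1} \<times> {6 / a..T'}) (\<lambda>l (x, t). DW l \<alpha> \<beta> x t)"
        by (rule Cauchy_uniformly_convergent)
      then show ?thesis
        unfolding uniformly_convergent_uniform_limit_iff D_def case_prod_unfold .
    qed
    have slice: "uniform_limit {0..1} (\<lambda>l x. DW l \<alpha> \<beta> x t) (\<lambda>x. D \<alpha> \<beta> x t) sequentially"
      if \<alpha>\<beta>: "\<alpha> + \<beta> \<le> 2" and t: "t \<ge> 6 / a" for \<alpha> \<beta> t
    proof -
      have "uniform_limit {0..1} (\<lambda>l y. case (y, t) of (x, t) \<Rightarrow> DW l \<alpha> \<beta> x t)
          (\<lambda>y. case (y, t) of (x, t) \<Rightarrow> D \<alpha> \<beta> x t) sequentially"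
        by (rule uniform_limit_compose'[OF unif[OF \<alpha>\<beta>, of t]]) (use t in auto)
      then show ?thesis
        by simp
    qed
    have cont: "continuous_on {0..1} (\<lambda>x. DW l \<alpha> \<beta> x t)" if "\<alpha> + \<beta> \<le> 2" "t \<ge> 6 / a" for l \<alpha> \<beta> t
    proof (rule continuous_on_strip_compose[where f = "DW l \<alpha> \<beta>" and g = "\<lambda>x. x" and h = "\<lambda>_. t"])
      show "continuous_on ({0..1} \<times> {0..}) (\<lambda>(x, t). DW l \<alpha> \<beta> x t)"
        using sol[of l] that by (simp add: solution_def C2_partials_def)
    qed (use order_trans[OF less_imp_le[OF T] that(2)] in \<open>auto intro: continuous_intros\<close>)
    have contD: "continuous_on {0..1} (\<lambda>x. D \<alpha> \<beta> x t)" if "\<alpha> + \<beta> \<le> 2" "t \<ge> 6 / a" for \<alpha> \<beta> t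
      by (rule uniform_limit_theorem[OF _ slice[OF that]]) (use cont[OF that] in auto)
    have W00: "DW l 0 0 x t = W l x t" if "x \<in> {0..1}" "t \<ge> 0" for l x t
      using C2_partials_C1_strip(4) sol[of l] that by (auto simp: solution_def)
    have AE: "AE x in unit_lebesgue. w x t = D 0 0 x t" if t: "t \<ge> 6 / a" for t
    proof (rule AE_eq_of_L2_limit[where W = "\<lambda>l x. DW l 0 0 x t"])
      have t0: "t > 0"
        using t T by linarith
      show "(\<lambda>x. w x t) \<in> L2"
        using w t0 by (simp add: continuous_into_L2_def)
      have "(\<lambda>l. L2_norm (\<lambda>x. w x t - W l x t)) \<longlonglongrightarrow> 0"
        using tendsto_uniform_limitI[OF Wlim[OF t0], of t] t0 by simp
      moreover have "L2_norm (\<lambda>x. w x t - W l x t) = L2_norm (\<lambda>x. w x t - DW l 0 0 x t)" for l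
        by (rule L2_norm_cong) (use t0 W00 in auto)
      ultimately show "(\<lambda>l. L2_norm (\<lambda>x. w x t - DW l 0 0 x t)) \<longlonglongrightarrow> 0"
        by simp
    qed (use cont contD slice t in auto)
    have ip: "iterated_partials (6 / a) (D 0 0) D"
    proof (rule iterated_partials_uniform_limit[OF _ _ unif])
      show "iterated_partials 0 (W l) (DW l)" for l
        using sol[of l] by (simp add: solution_def C2_partials_def)
    qed (use T in auto)
    have bd: "\<bar>D \<alpha> \<beta> x t\<bar> \<le> K * Q * exp (\<omega> * t) * m"
      if \<alpha>\<beta>: "\<alpha> + \<beta> \<le> 2" and t: "t \<ge> 6 / a" and x: "x \<in> {0..1}" for \<alpha> \<beta> x t
    proof -
      have lim: "(\<lambda>l. \<bar>DW l \<alpha> \<beta> x t\<bar>) \<longlonglongrightarrow> \<bar>D \<alpha> \<beta> x t\<bar>"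
        using tendsto_uniform_limitI[OF slice[OF \<alpha>\<beta> t] x] by (rule tendsto_rabs)
      \<comment> \<open>The margin \<open>\<epsilon>\<close> covers the approximation error and keeps the size of the data positive if \<open>m = 0\<close>.\<close>
      have 1: "\<bar>D \<alpha> \<beta> x t\<bar> \<le> K * (Q * m + \<epsilon>) * exp (\<omega> * t)" if "\<epsilon> > 0" for \<epsilon>
      proof (rule tendsto_upperbound[OF lim])
        have N: "Q * m + \<epsilon> > 0"
          using Q m that by (simp add: add_nonneg_pos)
        have N2: "Q\<^sup>2 * m\<^sup>2 + \<epsilon>\<^sup>2 \<le> (Q * m + \<epsilon>)\<^sup>2"
          using Q m that by (simp add: power2_sum power_mult_distrib)
        have "\<forall>\<^sub>F l in sequentially. err l < \<epsilon>\<^sup>2"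
          using err that by simp
        then show "\<forall>\<^sub>F l in sequentially. \<bar>DW l \<alpha> \<beta> x t\<bar> \<le> K * (Q * m + \<epsilon>) * exp (\<omega> * t)"
        proof (rule eventually_mono)
          show "err l < \<epsilon>\<^sup>2 \<Longrightarrow> \<bar>DW l \<alpha> \<beta> x t\<bar> \<le> K * (Q * m + \<epsilon>) * exp (\<omega> * t)" for l
            using bound[OF sol[of l] _ N \<alpha>\<beta> x t] near[of l] N2 by linarith
        qed
      qed simp
      have "((\<lambda>\<epsilon>. K * (Q * m + \<epsilon>) * exp (\<omega> * t)) \<longlongrightarrow> K * (Q * m + 0) * exp (\<omega> * t)) (at_right 0)"
        by (intro tendsto_intros)
      then have "\<bar>D \<alpha> \<beta> x t\<bar> \<le> K * (Q * m + 0) * exp (\<omega> * t)"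
        by (rule tendsto_lowerbound) (use 1 in \<open>auto simp: eventually_at_filter\<close>)
      then show ?thesis
        by (simp add: mult_ac)
    qed
    show "\<exists>D. (\<forall>t\<ge>6 / a. AE x in unit_lebesgue. w x t = D 0 0 x t) \<and> iterated_partials (6 / a) (D 0 0) D \<and>
      (\<forall>\<alpha> \<beta> t. \<alpha> + \<beta> \<le> 2 \<longrightarrow> t \<ge> 6 / a \<longrightarrow> continuous_on {0..1} (\<lambda>x. D \<alpha> \<beta> x t) \<and>
        (\<forall>x\<in>{0..1}. \<bar>D \<alpha> \<beta> x t\<bar> \<le> K * Q * exp (\<omega> * t) * max (H1_norm w0) (L2_norm w1)))"
      using AE ip contD bd unfolding m_def by blast
  qed
qed

end

theorem theorem1p3:
  fixes a p :: real and c :: "real \<Rightarrow> real \<Rightarrow> real"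
  assumes "a > 0" and "c \<in> bounded_C2_strip"
  shows "smoothing_L2_C2_from a p c (6 / a) \<and>
    (\<exists>M1 \<omega>. \<forall>w0\<in>H1. \<forall>w1\<in>L2. \<forall>w. L2_generalized_solution a p c w0 w1 w \<longrightarrow>
       (\<exists>v D. (\<forall>t\<ge>6 / a. AE x in unit_lebesgue. w x t = v x t) \<and>
              iterated_partials (6 / a) v D \<and>
              (\<forall>\<alpha> \<beta>. \<alpha> + \<beta> \<le> 2 \<longrightarrow> (\<forall>t\<ge>6 / a.
                 continuous_on {0..1} (\<lambda>x. D \<alpha> \<beta> x t) \<and>
                 C_norm (\<lambda>x. D \<alpha> \<beta> x t)
                   \<le> M1 * exp (\<omega> * t) * max (H1_norm w0) (L2_norm w1)))))"
proof -
  obtain Dc where Dc: "C2_partials c Dc"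
    and "\<And>\<alpha> \<beta>. \<alpha> + \<beta> \<le> 2 \<Longrightarrow> bounded ((\<lambda>(x, t). Dc \<alpha> \<beta> x t) ` ({0..1} \<times> {0..}))"
    using assms(2) unfolding bounded_C2_strip_def by blast
  then have "\<exists>B. \<forall>x\<in>{0..1}. \<forall>t\<ge>0. \<bar>Dc \<alpha> \<beta> x t\<bar> \<le> B" if "\<alpha> + \<beta> \<le> 2" for \<alpha> \<beta>
    using that unfolding bounded_iff by fastforce
  then obtain B where B: "\<And>\<alpha> \<beta> x t. \<lbrakk>\<alpha> + \<beta> \<le> 2; x \<in> {0..1}; t \<ge> 0\<rbrakk> \<Longrightarrow> \<bar>Dc \<alpha> \<beta> x t\<bar> \<le> B \<alpha> \<beta>"
    by metis
  define C where "C = (\<Sum>(\<alpha>, \<beta>)\<in>{..2} \<times> {..2}. \<bar>B \<alpha> \<beta>\<bar>)"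
  interpret dissipative_problem a p c Dc C
  proof
    fix \<alpha> \<beta> :: nat and x t :: real assume *: "\<alpha> + \<beta> \<le> 2" "x \<in> {0..1}" "t \<ge> 0"
    have "(case (\<alpha>, \<beta>) of (\<alpha>, \<beta>) \<Rightarrow> \<bar>B \<alpha> \<beta>\<bar>) \<le> C"
      unfolding C_def by (rule member_le_sum) (use * in auto)
    then show "\<bar>Dc \<alpha> \<beta> x t\<bar> \<le> C"
      using B[OF *] by simp
  qed (use assms Dc in auto)
  obtain M where M: "\<And>w0 w1 w. \<lbrakk>w0 \<in> H1; w1 \<in> L2; L2_generalized_solution a p c w0 w1 w\<rbrakk> \<Longrightarrow>
    \<exists>D. (\<forall>t\<ge>6 / a. AE x in unit_lebesgue. w x t = D 0 0 x t) \<and> iterated_partials (6 / a) (D 0 0) D \<and>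
      (\<forall>\<alpha> \<beta> t. \<alpha> + \<beta> \<le> 2 \<longrightarrow> t \<ge> 6 / a \<longrightarrow> continuous_on {0..1} (\<lambda>x. D \<alpha> \<beta> x t) \<and>
        (\<forall>x\<in>{0..1}. \<bar>D \<alpha> \<beta> x t\<bar> \<le> M * exp (\<omega> * t) * max (H1_norm w0) (L2_norm w1)))"
    using generalized_solution_regularity by blast
  have "\<exists>v D. (\<forall>t\<ge>6 / a. AE x in unit_lebesgue. w x t = v x t) \<and>
        iterated_partials (6 / a) v D \<and>
        (\<forall>\<alpha> \<beta>. \<alpha> + \<beta> \<le> 2 \<longrightarrow> (\<forall>t\<ge>6 / a. continuous_on {0..1} (\<lambda>x. D \<alpha> \<beta> x t) \<and>
           C_norm (\<lambda>x. D \<alpha> \<beta> x t) \<le> M * exp (\<omega> * t) * max (H1_norm w0) (L2_norm w1)))"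
    if gen: "w0 \<in> H1" "w1 \<in> L2" "L2_generalized_solution a p c w0 w1 w" for w0 w1 w
  proof -
    from M[OF gen] obtain D where D: "\<forall>t\<ge>6 / a. AE x in unit_lebesgue. w x t = D 0 0 x t"
      "iterated_partials (6 / a) (D 0 0) D"
      "\<And>\<alpha> \<beta> t. \<lbrakk>\<alpha> + \<beta> \<le> 2; t \<ge> 6 / a\<rbrakk> \<Longrightarrow> continuous_on {0..1} (\<lambda>x. D \<alpha> \<beta> x t)"
      "\<And>\<alpha> \<beta> t x. \<lbrakk>\<alpha> + \<beta> \<le> 2; t \<ge> 6 / a; x \<in> {0..1}\<rbrakk> \<Longrightarrow>
        \<bar>D \<alpha> \<beta> x t\<bar> \<le> M * exp (\<omega> * t) * max (H1_norm w0) (L2_norm w1)"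
      by blast
    have "C_norm (\<lambda>x. D \<alpha> \<beta> x t) \<le> M * exp (\<omega> * t) * max (H1_norm w0) (L2_norm w1)"
      if "\<alpha> + \<beta> \<le> 2" "t \<ge> 6 / a" for \<alpha> \<beta> t
      unfolding C_norm_def using D(4)[OF that] by (intro cSUP_least) auto
    then show ?thesis
      using D by (intro exI[of _ "D 0 0"] exI[of _ D]) blast
  qed
  note reg = this
  have "smoothing_L2_C2_from a p c (6 / a)"
    unfolding smoothing_L2_C2_from_def
  proof (intro conjI ballI allI impI)
    show "6 / a > 0"
      using assms by simp
    fix w0 w1 w t assume gen: "w0 \<in> H1" "w1 \<in> L2" "L2_generalized_solution a p c w0 w1 w" and t: "6 / a \<le> t"
    from M[OF gen] obtain D where D: "AE x in unit_lebesgue. w x t = D 0 0 x t"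
      "iterated_partials (6 / a) (D 0 0) D" "continuous_on {0..1} (\<lambda>x. D 2 0 x t)"
      using t by force
    have "((\<lambda>y. D 0 0 y t) has_real_derivative D 1 0 x t) (at x within {0..1})"
      "((\<lambda>y. D 1 0 y t) has_real_derivative D 2 0 x t) (at x within {0..1})" if "x \<in> {0..1}" for x
      using D(2) that t by (auto simp: iterated_partials_def numeral_2_eq_2)
    then have "(\<lambda>x. D 0 0 x t) \<in> C2_unit_interval"
      unfolding C2_unit_interval_def using D(3)
      by (intro CollectI exI[of _ "\<lambda>x. D 1 0 x t"] exI[of _ "\<lambda>x. D 2 0 x t"]) auto
    with D(1) show "\<exists>g\<in>C2_unit_interval. AE x in unit_lebesgue. w x t = g x"
      by (intro bexI[of _ "\<lambda>x. D 0 0 x t"])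
  qed
  then show ?thesis
    using reg by blast
qed

end
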